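(* Let $\underline{\mathsf{coCyl}}=(\mathsf{coCyl},e_0,e_1,c,v,\mathsf S,r_0,r_1,s,\Gamma_{lr})$ be a co-cylinder in a formal category $\mathcal A$ equipped with a contraction structure $c$, an involution structure $v$ compatible with $c$, a subdivision structure $(\mathsf S,r_0,r_1,s)$, and a lower right connection structure $\Gamma_{lr}$. Suppose that $\Gamma_{lr}$ is compatible with $c$, that $\underline{\mathsf{coCyl}}$ has strictness of identities, and that $\mathsf{coCyl}$ preserves mapping co-cylinders with respect to $\underline{\mathsf{coCyl}}$. Let $\underline{\mathsf{Cyl}}=(\mathsf{Cyl},i_0,i_1,p)$ be a cylinder in $\mathcal A$ equipped with a contraction structure $p$. Suppose that $\underline{\mathsf{Cyl}}$ is left adjoint to $\underline{\mathsf{coCyl}}$, and that the adjunction between $\mathsf{Cyl}$ and $\mathsf{coCyl}$ is compatible with $p$ and $c$. Let $f:a_0\to a_1$ be an arrow of $\mathcal A$, let $(b_f,d^0_f,d^1_f)$ be a mapping co-cylinder of $f$ with respect to $\underline{\mathsf{coCyl}}$, and let $f=g\circ j$, with $j:a_0\to b_f$ and $g:b_f\to a_1$, be the corresponding mapping co-cylinder factorisation of $f$. Then $j$ is a trivial cofibration with respect to $\underline{\mathsf{Cyl}}$, and $g$ is a normally cloven fibration with respect to $\underline{\mathsf{coCyl}}$.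
   Context: Formal categories. Let $\mathcal C$ be a strict 2-category with a final object $1$. For an object $\mathcal A$ of $\mathcal C$, an object of $\mathcal A$ is a 1-arrow $1\to\mathcal A$ and an arrow of $\mathcal A$ is a 2-arrow between such; composition, commutative diagrams, pushouts and pullbacks in $\mathcal A$ are those of the category $\mathrm{Hom}_{\mathcal C}(1,\mathcal A)$. For 1-arrows $F,F_0,F_1:\mathcal A\to\mathcal A$, a 2-arrow $\eta:F_0\to F_1$, an object $a$ and an arrow $f$ of $\mathcal A$: $F(a)=F\circ a$, $F(f)$ is the whiskering of $F$ and $f$, $\eta(a):F_0(a)\to F_1(a)$ is the whiskering of $\eta$ and $a$; $F\cdot\eta$, $\eta\cdot F$ are whiskerings. Standing assumption: for all objects $\mathcal A_0,\mathcal A_1$ of $\mathcal C$ and objects $a$ of $\mathcal A_0$, evaluation at $a$ sends pushout (resp. pullback) squares of $\mathrm{Hom}_{\mathcal C}(\mathcal A_0,\mathcal A_1)$ to pushout (resp. pullback) squares of $\mathcal A_1$. (For $\mathcal C$ the 2-category of categories these are ordinary categories, functors and natural transformations.) $\mathcal A$ is a fixed object of $\mathcal C$. A cylinder in $\mathcal A$ is a 1-arrow $\mathsf{Cyl}:\mathcal A\to\mathcal A$ with 2-arrows $i_0,i_1:\mathrm{id}_{\mathcal A}\to\mathsf{Cyl}$; contraction: $p:\mathsf{Cyl}\to\mathrm{id}_{\mathcal A}$ with $pi_0=pi_1=\mathrm{id}$. A co-cylinder in $\mathcal A$ is a 1-arrow $\mathsf{coCyl}:\mathcal A\to\mathcal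 A$ with 2-arrows $e_0,e_1:\mathsf{coCyl}\to\mathrm{id}_{\mathcal A}$. Contraction: $c:\mathrm{id}_{\mathcal A}\to\mathsf{coCyl}$ with $e_0c=e_1c=\mathrm{id}$. Involution: $v:\mathsf{coCyl}\to\mathsf{coCyl}$ with $e_0v=e_1$, $e_1v=e_0$; compatible with $c$ if $vc=c$. Subdivision: a 1-arrow $\mathsf S$, 2-arrows $r_0,r_1:\mathsf S\to\mathsf{coCyl}$ with $e_0r_0=e_1r_1$ a pullback square of $e_0$ and $e_1$ in $\mathrm{Hom}_{\mathcal C}(\mathcal A,\mathcal A)$, and $s:\mathsf S\to\mathsf{coCyl}$ with $e_0s=e_0r_1$, $e_1s=e_1r_0$. Lower right connection: $\Gamma_{lr}:\mathsf{coCyl}\to\mathsf{coCyl}^2$ with $(e_1\cdot\mathsf{coCyl})\Gamma_{lr}=(\mathsf{coCyl}\cdot e_1)\Gamma_{lr}=\mathrm{id}$, $(e_0\cdot\mathsf{coCyl})\Gamma_{lr}=(\mathsf{coCyl}\cdot e_0)\Gamma_{lr}=c\,e_0$; compatible with $c$ if $\Gamma_{lr}c=(c\cdot\mathsf{coCyl})c$. Strictness of identities: $sq_l=\mathrm{id}=sq_r$, where $q_l,q_r:\mathsf{coCyl}\to\mathsf S$ are the unique 2-arrows with $r_0q_l=\mathrm{id}$, $r_1q_l=c\,e_0$, $r_0q_r=c\,e_1$, $r_1q_r=\mathrm{id}$. $\underline{\mathsf{Cyl}}$ is left adjoint to $\underline{\mathsf{coCyl}}$ if $\mathsf{Cyl}$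 is left adjoint to $\mathsf{coCyl}$ in $\mathcal C$, with natural bijection $\mathsf{adj}:\mathrm{Hom}_{\mathcal A}(\mathsf{Cyl}(a_0),a_1)\to\mathrm{Hom}_{\mathcal A}(a_0,\mathsf{coCyl}(a_1))$, and $e_\epsilon(a_1)\circ\mathsf{adj}(h)=h\circ i_\epsilon(a_0)$ for $\epsilon=0,1$ and all $h$. The adjunction is compatible with $p$ and $c$ if $\mathsf{adj}(f\circ p(a_0))=c(a_1)\circ f$ for all $f:a_0\to a_1$. Mapping co-cylinder of $f:a_0\to a_1$: an object $b_f$ with $d^0_f:b_f\to a_0$, $d^1_f:b_f\to\mathsf{coCyl}(a_1)$ such that $f\circ d^0_f=e_0(a_1)\circ d^1_f$ is a pullback square. $\mathsf{coCyl}$ preserves mapping co-cylinders if it carries each such square to a pullback square. Mapping co-cylinder factorisation: $j:a_0\to b_f$ is the unique arrow with $d^0_f\circ j=\mathrm{id}$, $d^1_f\circ j=c(a_1)\circ f$, and $g=e_1(a_1)\circ d^1_f$. A homotopy from $f_0$ to $f_1$ ($f_0,f_1:a_0\to a_1$) with respect to $\underline{\mathsf{Cyl}}$ is $h:\mathsf{Cyl}(a_0)\to a_1$ with $h\circ i_0(a_0)=f_0$, $h\circ i_1(a_0)=f_1$; $f$ is a homotopy equivalence if there are $f^{-1}$ and homotopies from $f^{-1}f$ and $ff^{-1}$ to the identities. Cofibration with respect to $\underline{\mathsf{Cyl}}$: $j:a_0\to a_1$ such that for all $f:a_1\to a_2$, $h:\mathsf{Cyl}(a_0)\to a_2$ with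 $h\circ i_0(a_0)=f\circ j$ there is $k:\mathsf{Cyl}(a_1)\to a_2$ with $k\circ\mathsf{Cyl}(j)=h$, $k\circ i_0(a_1)=f$. Trivial cofibration: both a cofibration and a homotopy equivalence with respect to $\underline{\mathsf{Cyl}}$. Normally cloven fibration with respect to $\underline{\mathsf{coCyl}}$: $f:a_1\to a_2$ for which one can choose, for every object $a_0$ and all $g:a_0\to a_1$, $h:a_0\to\mathsf{coCyl}(a_2)$ with $e_0(a_2)\circ h=f\circ g$, an arrow $k_{a_0}(g,h):a_0\to\mathsf{coCyl}(a_1)$ with $\mathsf{coCyl}(f)\circ k_{a_0}(g,h)=h$, $e_0(a_1)\circ k_{a_0}(g,h)=g$, such that (i) $k_{a_0}(g,c(a_2)\circ f\circ g)=c(a_1)\circ g$, and (ii) $k_{a_{-1}}(g\circ u,h\circ u)=k_{a_0}(g,h)\circ u$ for all $u:a_{-1}\to a_0$. *)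

theory Defs
  imports Main
begin

section \<open>Strict 2-categories\<close>

record ('o, 'm, 't) two_cells =
  obj :: "'o set"
  arr1 :: "'m set"
  src1 :: "'m \<Rightarrow> 'o"
  trg1 :: "'m \<Rightarrow> 'o"
  id1 :: "'o \<Rightarrow> 'm"
  comp1 :: "'m \<Rightarrow> 'm \<Rightarrow> 'm"  (infixl "\<odot>\<index>" 75)
  arr2 :: "'t set"
  src2 :: "'t \<Rightarrow> 'm"
  trg2 :: "'t \<Rightarrow> 'm"
  id2 :: "'m \<Rightarrow> 't"
  vcomp :: "'t \<Rightarrow> 't \<Rightarrow> 't"  (infixl "\<cdot>\<index>" 70)
  hcomp :: "'t \<Rightarrow> 't \<Rightarrow> 't"  (infixl "\<star>\<index>" 75)

text \<open>All compositions are written in applicative order: in \<open>G \<odot> F\<close>, \<open>\<theta> \<cdot> \<eta>\<close> and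
  \<open>\<theta> \<star> \<eta>\<close> the right-hand factor comes first.\<close>

definition hom1 :: "('o, 'm, 't, 'x) two_cells_scheme \<Rightarrow> 'o \<Rightarrow> 'o \<Rightarrow> 'm set" where
  "hom1 C X Y = {F \<in> arr1 C. src1 C F = X \<and> trg1 C F = Y}"

definition hom2 :: "('o, 'm, 't, 'x) two_cells_scheme \<Rightarrow> 'm \<Rightarrow> 'm \<Rightarrow> 't set" where
  "hom2 C F G = {\<eta> \<in> arr2 C. src2 C \<eta> = F \<and> trg2 C \<eta> = G}"

locale strict_2_category =
  fixes C :: "('o, 'm, 't, 'x) two_cells_scheme" (structure)
  assumes src1_obj: "F \<in> arr1 C \<Longrightarrow> src1 C F \<in> obj C"
    and trg1_obj: "F \<in> arr1 C \<Longrightarrow> trg1 C F \<in> obj C"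
    and id1_hom: "X \<in> obj C \<Longrightarrow> id1 C X \<in> hom1 C X X"
    and comp1_hom: "\<lbrakk>F \<in> hom1 C X Y; G \<in> hom1 C Y Z\<rbrakk> \<Longrightarrow> G \<odot> F \<in> hom1 C X Z"
    and comp1_id_left: "F \<in> hom1 C X Y \<Longrightarrow> id1 C Y \<odot> F = F"
    and comp1_id_right: "F \<in> hom1 C X Y \<Longrightarrow> F \<odot> id1 C X = F"
    and comp1_assoc:
      "\<lbrakk>F \<in> hom1 C W X; G \<in> hom1 C X Y; H \<in> hom1 C Y Z\<rbrakk> \<Longrightarrow> (H \<odot> G) \<odot> F = H \<odot> (G \<odot> F)"
    and src2_arr1: "\<eta> \<in> arr2 C \<Longrightarrow> src2 C \<eta> \<in> arr1 C"
    and trg2_arr1: "\<eta> \<in> arr2 C \<Longrightarrow> trg2 C \<eta> \<in> arr1 C"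
    and src1_parallel: "\<eta> \<in> arr2 C \<Longrightarrow> src1 C (src2 C \<eta>) = src1 C (trg2 C \<eta>)"
    and trg1_parallel: "\<eta> \<in> arr2 C \<Longrightarrow> trg1 C (src2 C \<eta>) = trg1 C (trg2 C \<eta>)"
    and id2_hom: "F \<in> arr1 C \<Longrightarrow> id2 C F \<in> hom2 C F F"
    and vcomp_hom: "\<lbrakk>\<eta> \<in> hom2 C F G; \<theta> \<in> hom2 C G H\<rbrakk> \<Longrightarrow> \<theta> \<cdot> \<eta> \<in> hom2 C F H"
    and vcomp_id_left: "\<eta> \<in> hom2 C F G \<Longrightarrow> id2 C G \<cdot> \<eta> = \<eta>"
    and vcomp_id_right: "\<eta> \<in> hom2 C F G \<Longrightarrow> \<eta> \<cdot> id2 C F = \<eta>"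
    and vcomp_assoc:
      "\<lbrakk>\<eta> \<in> hom2 C F G; \<theta> \<in> hom2 C G H; \<zeta> \<in> hom2 C H K\<rbrakk>
        \<Longrightarrow> (\<zeta> \<cdot> \<theta>) \<cdot> \<eta> = \<zeta> \<cdot> (\<theta> \<cdot> \<eta>)"
    and hcomp_hom:
      "\<lbrakk>F \<in> hom1 C X Y; G \<in> hom1 C Y Z; \<eta> \<in> hom2 C F F'; \<theta> \<in> hom2 C G G'\<rbrakk>
        \<Longrightarrow> \<theta> \<star> \<eta> \<in> hom2 C (G \<odot> F) (G' \<odot> F')"
    and hcomp_id2:
      "\<lbrakk>F \<in> hom1 C X Y; G \<in> hom1 C Y Z\<rbrakk> \<Longrightarrow> id2 C G \<star> id2 C F = id2 C (G \<odot> F)"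
    and interchange:
      "\<lbrakk>F \<in> hom1 C X Y; G \<in> hom1 C Y Z; \<eta> \<in> hom2 C F F'; \<eta>' \<in> hom2 C F' F'';
        \<theta> \<in> hom2 C G G'; \<theta>' \<in> hom2 C G' G''\<rbrakk>
        \<Longrightarrow> (\<theta>' \<cdot> \<theta>) \<star> (\<eta>' \<cdot> \<eta>) = (\<theta>' \<star> \<eta>') \<cdot> (\<theta> \<star> \<eta>)"
    and hcomp_id_left:
      "\<lbrakk>F \<in> hom1 C X Y; \<eta> \<in> hom2 C F F'\<rbrakk> \<Longrightarrow> id2 C (id1 C Y) \<star> \<eta> = \<eta>"
    and hcomp_id_right:
      "\<lbrakk>F \<in> hom1 C X Y; \<eta> \<in> hom2 C F F'\<rbrakk> \<Longrightarrow> \<eta> \<star> id2 C (id1 C X) = \<eta>"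
    and hcomp_assoc:
      "\<lbrakk>F \<in> hom1 C W X; G \<in> hom1 C X Y; H \<in> hom1 C Y Z;
        \<eta> \<in> hom2 C F F'; \<theta> \<in> hom2 C G G'; \<zeta> \<in> hom2 C H H'\<rbrakk>
        \<Longrightarrow> (\<zeta> \<star> \<theta>) \<star> \<eta> = \<zeta> \<star> (\<theta> \<star> \<eta>)"

definition lwhisker ::
  "('o, 'm, 't, 'x) two_cells_scheme \<Rightarrow> 'm \<Rightarrow> 't \<Rightarrow> 't"  (infixr "\<triangleright>\<index>" 76) where
  "F \<triangleright>\<^bsub>C\<^esub> \<eta> = id2 C F \<star>\<^bsub>C\<^esub> \<eta>"

definition rwhisker ::
  "('o, 'm, 't, 'x) two_cells_scheme \<Rightarrow> 't \<Rightarrow> 'm \<Rightarrow> 't"  (infixl "\<triangleleft>\<index>" 76) where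
  "\<eta> \<triangleleft>\<^bsub>C\<^esub> F = \<eta> \<star>\<^bsub>C\<^esub> id2 C F"

context
  fixes C :: "('o, 'm, 't, 'x) two_cells_scheme" (structure)
begin

text \<open>Final in the 2-categorical sense: \<open>Hom(X, one)\<close> is the category with one object and
  one arrow, for every \<open>X\<close>.\<close>

definition final_object :: "'o \<Rightarrow> bool" where
  "final_object one \<longleftrightarrow> one \<in> obj C \<and>
     (\<forall>X \<in> obj C. \<exists>F. hom1 C X one = {F} \<and> hom2 C F F = {id2 C F})"

text \<open>\<open>pullback_square X Y p q f g\<close> and \<open>pushout_square X Y f g p q\<close>: the square
  \<open>f \<cdot> p = g \<cdot> q\<close>, resp. \<open>p \<cdot> f = q \<cdot> g\<close>, is a pullback, resp. pushout, in the category
  \<open>Hom(X, Y)\<close>.\<close>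

definition pullback_square :: "'o \<Rightarrow> 'o \<Rightarrow> 't \<Rightarrow> 't \<Rightarrow> 't \<Rightarrow> 't \<Rightarrow> bool" where
  "pullback_square X Y p q f g \<longleftrightarrow>
     (\<exists>P \<in> hom1 C X Y. \<exists>B \<in> hom1 C X Y. \<exists>D \<in> hom1 C X Y. \<exists>E \<in> hom1 C X Y.
        p \<in> hom2 C P B \<and> q \<in> hom2 C P D \<and> f \<in> hom2 C B E \<and> g \<in> hom2 C D E \<and>
        f \<cdot> p = g \<cdot> q \<and>
        (\<forall>W \<in> hom1 C X Y. \<forall>u \<in> hom2 C W B. \<forall>w \<in> hom2 C W D.
           f \<cdot> u = g \<cdot> w \<longrightarrow> (\<exists>!t. t \<in> hom2 C W P \<and> p \<cdot> t = u \<and> q \<cdot> t = w)))"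

definition pushout_square :: "'o \<Rightarrow> 'o \<Rightarrow> 't \<Rightarrow> 't \<Rightarrow> 't \<Rightarrow> 't \<Rightarrow> bool" where
  "pushout_square X Y f g p q \<longleftrightarrow>
     (\<exists>P \<in> hom1 C X Y. \<exists>B \<in> hom1 C X Y. \<exists>D \<in> hom1 C X Y. \<exists>E \<in> hom1 C X Y.
        f \<in> hom2 C E B \<and> g \<in> hom2 C E D \<and> p \<in> hom2 C B P \<and> q \<in> hom2 C D P \<and>
        p \<cdot> f = q \<cdot> g \<and>
        (\<forall>W \<in> hom1 C X Y. \<forall>u \<in> hom2 C B W. \<forall>w \<in> hom2 C D W.
           u \<cdot> f = w \<cdot> g \<longrightarrow> (\<exists>!t. t \<in> hom2 C P W \<and> t \<cdot> p = u \<and> t \<cdot> q = w)))"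

end

section \<open>Formal categories\<close>

text \<open>Objects of the formal category \<open>A\<close> are the elements of \<open>hom1 C one A\<close>, and the arrows
  from \<open>a\<^sub>0\<close> to \<open>a\<^sub>1\<close> those of \<open>hom2 C a\<^sub>0 a\<^sub>1\<close>. Thus \<open>F(a)\<close>, \<open>F(f)\<close> and \<open>\<eta>(a)\<close> are
  \<open>F \<odot> a\<close>, \<open>F \<triangleright> f\<close> and \<open>\<eta> \<triangleleft> a\<close>.\<close>

locale formal_category = strict_2_category +
  fixes one :: 'b and A :: 'b
  assumes final: "final_object C one"
    and A_obj: "A \<in> obj C"
    and eval_pullback:
      "\<lbrakk>A\<^sub>0 \<in> obj C; A\<^sub>1 \<in> obj C; a \<in> hom1 C one A\<^sub>0; pullback_square C A\<^sub>0 A\<^sub>1 p q f g\<rbrakk>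
        \<Longrightarrow> pullback_square C one A\<^sub>1 (p \<triangleleft> a) (q \<triangleleft> a) (f \<triangleleft> a) (g \<triangleleft> a)"
    and eval_pushout:
      "\<lbrakk>A\<^sub>0 \<in> obj C; A\<^sub>1 \<in> obj C; a \<in> hom1 C one A\<^sub>0; pushout_square C A\<^sub>0 A\<^sub>1 f g p q\<rbrakk>
        \<Longrightarrow> pushout_square C one A\<^sub>1 (f \<triangleleft> a) (g \<triangleleft> a) (p \<triangleleft> a) (q \<triangleleft> a)"

context
  fixes C :: "('o, 'm, 't, 'x) two_cells_scheme" (structure)
begin

section \<open>Cylinders and co-cylinders\<close>

definition cylinder :: "'o \<Rightarrow> 'm \<Rightarrow> 't \<Rightarrow> 't \<Rightarrow> bool" where
  "cylinder A Cyl i\<^sub>0 i\<^sub>1 \<longleftrightarrow>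
     Cyl \<in> hom1 C A A \<and> i\<^sub>0 \<in> hom2 C (id1 C A) Cyl \<and> i\<^sub>1 \<in> hom2 C (id1 C A) Cyl"

definition cyl_contraction :: "'o \<Rightarrow> 'm \<Rightarrow> 't \<Rightarrow> 't \<Rightarrow> 't \<Rightarrow> bool" where
  "cyl_contraction A Cyl i\<^sub>0 i\<^sub>1 p \<longleftrightarrow>
     p \<in> hom2 C Cyl (id1 C A) \<and>
     p \<cdot> i\<^sub>0 = id2 C (id1 C A) \<and> p \<cdot> i\<^sub>1 = id2 C (id1 C A)"

definition cocylinder :: "'o \<Rightarrow> 'm \<Rightarrow> 't \<Rightarrow> 't \<Rightarrow> bool" where
  "cocylinder A coCyl e\<^sub>0 e\<^sub>1 \<longleftrightarrow>
     coCyl \<in> hom1 C A A \<and> e\<^sub>0 \<in> hom2 C coCyl (id1 C A) \<and> e\<^sub>1 \<in> hom2 C coCyl (id1 C A)"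

definition cocyl_contraction :: "'o \<Rightarrow> 'm \<Rightarrow> 't \<Rightarrow> 't \<Rightarrow> 't \<Rightarrow> bool" where
  "cocyl_contraction A coCyl e\<^sub>0 e\<^sub>1 c \<longleftrightarrow>
     c \<in> hom2 C (id1 C A) coCyl \<and>
     e\<^sub>0 \<cdot> c = id2 C (id1 C A) \<and> e\<^sub>1 \<cdot> c = id2 C (id1 C A)"

definition involution :: "'m \<Rightarrow> 't \<Rightarrow> 't \<Rightarrow> 't \<Rightarrow> bool" where
  "involution coCyl e\<^sub>0 e\<^sub>1 v \<longleftrightarrow>
     v \<in> hom2 C coCyl coCyl \<and> e\<^sub>0 \<cdot> v = e\<^sub>1 \<and> e\<^sub>1 \<cdot> v = e\<^sub>0"

definition involution_compatible :: "'t \<Rightarrow> 't \<Rightarrow> bool" where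
  "involution_compatible c v \<longleftrightarrow> v \<cdot> c = c"

definition subdivision ::
  "'o \<Rightarrow> 'm \<Rightarrow> 't \<Rightarrow> 't \<Rightarrow> 'm \<Rightarrow> 't \<Rightarrow> 't \<Rightarrow> 't \<Rightarrow> bool" where
  "subdivision A coCyl e\<^sub>0 e\<^sub>1 S r\<^sub>0 r\<^sub>1 s \<longleftrightarrow>
     S \<in> hom1 C A A \<and> r\<^sub>0 \<in> hom2 C S coCyl \<and> r\<^sub>1 \<in> hom2 C S coCyl \<and>
     pullback_square C A A r\<^sub>0 r\<^sub>1 e\<^sub>0 e\<^sub>1 \<and>
     s \<in> hom2 C S coCyl \<and> e\<^sub>0 \<cdot> s = e\<^sub>0 \<cdot> r\<^sub>1 \<and> e\<^sub>1 \<cdot> s = e\<^sub>1 \<cdot> r\<^sub>0"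

definition lower_right_connection :: "'m \<Rightarrow> 't \<Rightarrow> 't \<Rightarrow> 't \<Rightarrow> 't \<Rightarrow> bool" where
  "lower_right_connection coCyl e\<^sub>0 e\<^sub>1 c \<Gamma> \<longleftrightarrow>
     \<Gamma> \<in> hom2 C coCyl (coCyl \<odot> coCyl) \<and>
     (e\<^sub>1 \<triangleleft> coCyl) \<cdot> \<Gamma> = id2 C coCyl \<and> (coCyl \<triangleright> e\<^sub>1) \<cdot> \<Gamma> = id2 C coCyl \<and>
     (e\<^sub>0 \<triangleleft> coCyl) \<cdot> \<Gamma> = c \<cdot> e\<^sub>0 \<and> (coCyl \<triangleright> e\<^sub>0) \<cdot> \<Gamma> = c \<cdot> e\<^sub>0"

definition connection_compatible :: "'m \<Rightarrow> 't \<Rightarrow> 't \<Rightarrow> bool" where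
  "connection_compatible coCyl c \<Gamma> \<longleftrightarrow> \<Gamma> \<cdot> c = (c \<triangleleft> coCyl) \<cdot> c"

text \<open>The descriptions below are meaningful for a subdivision: existence and uniqueness are
  then provided by the pullback property of \<open>S\<close>.\<close>

definition q_left :: "'m \<Rightarrow> 't \<Rightarrow> 't \<Rightarrow> 'm \<Rightarrow> 't \<Rightarrow> 't \<Rightarrow> 't" where
  "q_left coCyl e\<^sub>0 c S r\<^sub>0 r\<^sub>1 =
     (THE q. q \<in> hom2 C coCyl S \<and> r\<^sub>0 \<cdot> q = id2 C coCyl \<and> r\<^sub>1 \<cdot> q = c \<cdot> e\<^sub>0)"

definition q_right :: "'m \<Rightarrow> 't \<Rightarrow> 't \<Rightarrow> 'm \<Rightarrow> 't \<Rightarrow> 't \<Rightarrow> 't" where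
  "q_right coCyl e\<^sub>1 c S r\<^sub>0 r\<^sub>1 =
     (THE q. q \<in> hom2 C coCyl S \<and> r\<^sub>0 \<cdot> q = c \<cdot> e\<^sub>1 \<and> r\<^sub>1 \<cdot> q = id2 C coCyl)"

definition strictness_of_identities ::
  "'m \<Rightarrow> 't \<Rightarrow> 't \<Rightarrow> 't \<Rightarrow> 'm \<Rightarrow> 't \<Rightarrow> 't \<Rightarrow> 't \<Rightarrow> bool" where
  "strictness_of_identities coCyl e\<^sub>0 e\<^sub>1 c S r\<^sub>0 r\<^sub>1 s \<longleftrightarrow>
     s \<cdot> q_left coCyl e\<^sub>0 c S r\<^sub>0 r\<^sub>1 = id2 C coCyl \<and>
     s \<cdot> q_right coCyl e\<^sub>1 c S r\<^sub>0 r\<^sub>1 = id2 C coCyl"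

section \<open>Adjunctions\<close>

definition adjunction :: "'o \<Rightarrow> 'o \<Rightarrow> 'm \<Rightarrow> 'm \<Rightarrow> 't \<Rightarrow> 't \<Rightarrow> bool" where
  "adjunction X Y L R \<eta> \<epsilon> \<longleftrightarrow>
     L \<in> hom1 C X Y \<and> R \<in> hom1 C Y X \<and>
     \<eta> \<in> hom2 C (id1 C X) (R \<odot> L) \<and> \<epsilon> \<in> hom2 C (L \<odot> R) (id1 C Y) \<and>
     (\<epsilon> \<triangleleft> L) \<cdot> (L \<triangleright> \<eta>) = id2 C L \<and> (R \<triangleright> \<epsilon>) \<cdot> (\<eta> \<triangleleft> R) = id2 C R"

text \<open>The bijection \<open>Hom(L(a), b) \<rightarrow> Hom(a, R(b))\<close> induced by an adjunction with unit \<open>\<eta>\<close>.\<close>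

definition adj :: "'m \<Rightarrow> 't \<Rightarrow> 'm \<Rightarrow> 't \<Rightarrow> 't" where
  "adj R \<eta> a h = (R \<triangleright> h) \<cdot> (\<eta> \<triangleleft> a)"

definition cylinder_adjunction ::
  "'o \<Rightarrow> 'o \<Rightarrow> 'm \<Rightarrow> 't \<Rightarrow> 't \<Rightarrow> 'm \<Rightarrow> 't \<Rightarrow> 't \<Rightarrow> 't \<Rightarrow> 't \<Rightarrow> bool" where
  "cylinder_adjunction one A Cyl i\<^sub>0 i\<^sub>1 coCyl e\<^sub>0 e\<^sub>1 \<eta> \<epsilon> \<longleftrightarrow>
     adjunction A A Cyl coCyl \<eta> \<epsilon> \<and>
     (\<forall>a\<^sub>0 \<in> hom1 C one A. \<forall>a\<^sub>1 \<in> hom1 C one A. \<forall>h \<in> hom2 C (Cyl \<odot> a\<^sub>0) a\<^sub>1.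
        (e\<^sub>0 \<triangleleft> a\<^sub>1) \<cdot> adj coCyl \<eta> a\<^sub>0 h = h \<cdot> (i\<^sub>0 \<triangleleft> a\<^sub>0) \<and>
        (e\<^sub>1 \<triangleleft> a\<^sub>1) \<cdot> adj coCyl \<eta> a\<^sub>0 h = h \<cdot> (i\<^sub>1 \<triangleleft> a\<^sub>0))"

definition adjunction_compatible :: "'o \<Rightarrow> 'o \<Rightarrow> 't \<Rightarrow> 'm \<Rightarrow> 't \<Rightarrow> 't \<Rightarrow> bool" where
  "adjunction_compatible one A p coCyl c \<eta> \<longleftrightarrow>
     (\<forall>a\<^sub>0 \<in> hom1 C one A. \<forall>a\<^sub>1 \<in> hom1 C one A. \<forall>f \<in> hom2 C a\<^sub>0 a\<^sub>1.
        adj coCyl \<eta> a\<^sub>0 (f \<cdot> (p \<triangleleft> a\<^sub>0)) = (c \<triangleleft> a\<^sub>1) \<cdot> f)"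

section \<open>Mapping co-cylinders\<close>

definition mapping_cocylinder ::
  "'o \<Rightarrow> 'o \<Rightarrow> 'm \<Rightarrow> 't \<Rightarrow> 'm \<Rightarrow> 'm \<Rightarrow> 't \<Rightarrow> 'm \<Rightarrow> 't \<Rightarrow> 't \<Rightarrow> bool" where
  "mapping_cocylinder one A coCyl e\<^sub>0 a\<^sub>0 a\<^sub>1 f b d\<^sub>0 d\<^sub>1 \<longleftrightarrow>
     b \<in> hom1 C one A \<and> d\<^sub>0 \<in> hom2 C b a\<^sub>0 \<and> d\<^sub>1 \<in> hom2 C b (coCyl \<odot> a\<^sub>1) \<and>
     pullback_square C one A d\<^sub>0 d\<^sub>1 f (e\<^sub>0 \<triangleleft> a\<^sub>1)"

definition preserves_mapping_cocylinders :: "'o \<Rightarrow> 'o \<Rightarrow> 'm \<Rightarrow> 't \<Rightarrow> bool" where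
  "preserves_mapping_cocylinders one A coCyl e\<^sub>0 \<longleftrightarrow>
     (\<forall>a\<^sub>0 \<in> hom1 C one A. \<forall>a\<^sub>1 \<in> hom1 C one A. \<forall>f \<in> hom2 C a\<^sub>0 a\<^sub>1. \<forall>b d\<^sub>0 d\<^sub>1.
        mapping_cocylinder one A coCyl e\<^sub>0 a\<^sub>0 a\<^sub>1 f b d\<^sub>0 d\<^sub>1 \<longrightarrow>
        pullback_square C one A
          (coCyl \<triangleright> d\<^sub>0) (coCyl \<triangleright> d\<^sub>1) (coCyl \<triangleright> f) (coCyl \<triangleright> (e\<^sub>0 \<triangleleft> a\<^sub>1)))"

text \<open>For a mapping co-cylinder \<open>(b, d\<^sub>0, d\<^sub>1)\<close> of \<open>f\<close>, the pullback property makes \<open>j\<close> the unique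
  arrow satisfying these conditions, and \<open>g \<cdot> j = f\<close> follows from \<open>e\<^sub>1 \<cdot> c = id\<close>.\<close>

definition mapping_cocylinder_factorisation ::
  "'t \<Rightarrow> 't \<Rightarrow> 'm \<Rightarrow> 'm \<Rightarrow> 't \<Rightarrow> 'm \<Rightarrow> 't \<Rightarrow> 't \<Rightarrow> 't \<Rightarrow> 't \<Rightarrow> bool" where
  "mapping_cocylinder_factorisation e\<^sub>1 c a\<^sub>0 a\<^sub>1 f b d\<^sub>0 d\<^sub>1 j g \<longleftrightarrow>
     j \<in> hom2 C a\<^sub>0 b \<and> d\<^sub>0 \<cdot> j = id2 C a\<^sub>0 \<and> d\<^sub>1 \<cdot> j = (c \<triangleleft> a\<^sub>1) \<cdot> f \<and>
     g = (e\<^sub>1 \<triangleleft> a\<^sub>1) \<cdot> d\<^sub>1"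

section \<open>Homotopy equivalences, cofibrations and fibrations\<close>

definition homotopy :: "'m \<Rightarrow> 't \<Rightarrow> 't \<Rightarrow> 'm \<Rightarrow> 'm \<Rightarrow> 't \<Rightarrow> 't \<Rightarrow> 't \<Rightarrow> bool" where
  "homotopy Cyl i\<^sub>0 i\<^sub>1 a\<^sub>0 a\<^sub>1 f\<^sub>0 f\<^sub>1 h \<longleftrightarrow>
     h \<in> hom2 C (Cyl \<odot> a\<^sub>0) a\<^sub>1 \<and> h \<cdot> (i\<^sub>0 \<triangleleft> a\<^sub>0) = f\<^sub>0 \<and> h \<cdot> (i\<^sub>1 \<triangleleft> a\<^sub>0) = f\<^sub>1"

definition homotopy_equivalence :: "'m \<Rightarrow> 't \<Rightarrow> 't \<Rightarrow> 'm \<Rightarrow> 'm \<Rightarrow> 't \<Rightarrow> bool" where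
  "homotopy_equivalence Cyl i\<^sub>0 i\<^sub>1 a\<^sub>0 a\<^sub>1 f \<longleftrightarrow>
     f \<in> hom2 C a\<^sub>0 a\<^sub>1 \<and>
     (\<exists>f' \<in> hom2 C a\<^sub>1 a\<^sub>0.
        (\<exists>h. homotopy Cyl i\<^sub>0 i\<^sub>1 a\<^sub>0 a\<^sub>0 (f' \<cdot> f) (id2 C a\<^sub>0) h) \<and>
        (\<exists>h. homotopy Cyl i\<^sub>0 i\<^sub>1 a\<^sub>1 a\<^sub>1 (f \<cdot> f') (id2 C a\<^sub>1) h))"

definition cofibration :: "'o \<Rightarrow> 'o \<Rightarrow> 'm \<Rightarrow> 't \<Rightarrow> 'm \<Rightarrow> 'm \<Rightarrow> 't \<Rightarrow> bool" where
  "cofibration one A Cyl i\<^sub>0 a\<^sub>0 a\<^sub>1 j \<longleftrightarrow>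
     j \<in> hom2 C a\<^sub>0 a\<^sub>1 \<and>
     (\<forall>a\<^sub>2 \<in> hom1 C one A. \<forall>f \<in> hom2 C a\<^sub>1 a\<^sub>2. \<forall>h \<in> hom2 C (Cyl \<odot> a\<^sub>0) a\<^sub>2.
        h \<cdot> (i\<^sub>0 \<triangleleft> a\<^sub>0) = f \<cdot> j \<longrightarrow>
        (\<exists>k \<in> hom2 C (Cyl \<odot> a\<^sub>1) a\<^sub>2. k \<cdot> (Cyl \<triangleright> j) = h \<and> k \<cdot> (i\<^sub>0 \<triangleleft> a\<^sub>1) = f))"

definition trivial_cofibration ::
  "'o \<Rightarrow> 'o \<Rightarrow> 'm \<Rightarrow> 't \<Rightarrow> 't \<Rightarrow> 'm \<Rightarrow> 'm \<Rightarrow> 't \<Rightarrow> bool" where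
  "trivial_cofibration one A Cyl i\<^sub>0 i\<^sub>1 a\<^sub>0 a\<^sub>1 j \<longleftrightarrow>
     cofibration one A Cyl i\<^sub>0 a\<^sub>0 a\<^sub>1 j \<and> homotopy_equivalence Cyl i\<^sub>0 i\<^sub>1 a\<^sub>0 a\<^sub>1 j"

definition normally_cloven_fibration ::
  "'o \<Rightarrow> 'o \<Rightarrow> 'm \<Rightarrow> 't \<Rightarrow> 't \<Rightarrow> 'm \<Rightarrow> 'm \<Rightarrow> 't \<Rightarrow> bool" where
  "normally_cloven_fibration one A coCyl e\<^sub>0 c a\<^sub>1 a\<^sub>2 f \<longleftrightarrow>
     f \<in> hom2 C a\<^sub>1 a\<^sub>2 \<and>
     (\<exists>k :: 'm \<Rightarrow> 't \<Rightarrow> 't \<Rightarrow> 't.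
        (\<forall>a\<^sub>0 \<in> hom1 C one A. \<forall>g \<in> hom2 C a\<^sub>0 a\<^sub>1. \<forall>h \<in> hom2 C a\<^sub>0 (coCyl \<odot> a\<^sub>2).
           (e\<^sub>0 \<triangleleft> a\<^sub>2) \<cdot> h = f \<cdot> g \<longrightarrow>
           k a\<^sub>0 g h \<in> hom2 C a\<^sub>0 (coCyl \<odot> a\<^sub>1) \<and>
           (coCyl \<triangleright> f) \<cdot> k a\<^sub>0 g h = h \<and> (e\<^sub>0 \<triangleleft> a\<^sub>1) \<cdot> k a\<^sub>0 g h = g) \<and>
        (\<forall>a\<^sub>0 \<in> hom1 C one A. \<forall>g \<in> hom2 C a\<^sub>0 a\<^sub>1.
           k a\<^sub>0 g ((c \<triangleleft> a\<^sub>2) \<cdot> (f \<cdot> g)) = (c \<triangleleft> a\<^sub>1) \<cdot> g) \<and>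
        (\<forall>a\<^sub>0 \<in> hom1 C one A. \<forall>g \<in> hom2 C a\<^sub>0 a\<^sub>1. \<forall>h \<in> hom2 C a\<^sub>0 (coCyl \<odot> a\<^sub>2).
           (e\<^sub>0 \<triangleleft> a\<^sub>2) \<cdot> h = f \<cdot> g \<longrightarrow>
           (\<forall>a' \<in> hom1 C one A. \<forall>u \<in> hom2 C a' a\<^sub>0.
              k a' (g \<cdot> u) (h \<cdot> u) = k a\<^sub>0 g h \<cdot> u)))"

end

end

theory Submission
  imports Defs
begin

text \<open>Write \<open>P\<close> for \<open>coCyl\<close> and read an arrow into \<open>P(a)\<close> as a path in \<open>a\<close>, starting at its
  \<open>e\<^sub>0\<close> and ending at its \<open>e\<^sub>1\<close>. An arrow into \<open>b\<close> is then a pair of an arrow \<open>x\<close> into \<open>a\<^sub>0\<close> and a path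
  \<open>\<gamma>\<close> in \<open>a\<^sub>1\<close> starting at \<open>f x\<close>; \<open>j\<close> sends \<open>x\<close> to \<open>(x, constant path)\<close> and \<open>g\<close> sends \<open>(x, \<gamma>)\<close> to the end
  point of \<open>\<gamma>\<close>. The topological argument for the path fibration is carried out in this language.

  Fibration. Let \<open>h\<close> be a path starting at the end point of \<open>\<gamma>\<close>. A lift of \<open>h\<close> is a path in \<open>b\<close>, and
  since \<open>P\<close> preserves the pullback defining \<open>b\<close> it consists of a path in \<open>a\<^sub>0\<close>, taken to be constant at
  \<open>x\<close>, and a square in \<open>a\<^sub>1\<close> that grows from \<open>\<gamma>\<close> into the concatenation of \<open>\<gamma>\<close> and \<open>h\<close>. Such a square is
  obtained by concatenating the degenerate square on \<open>\<gamma>\<close> with the connection square \<open>\<Gamma>(h)\<close>, one path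
  after another (lemma \<open>connection_square\<close>). It is defined on the universal pair of composable paths,
  so the lifts are stable under precomposition; that a constant \<open>h\<close> has a constant lift is the
  strictness of identities together with \<open>\<Gamma> c = (c \<triangleleft> P) c\<close>.

  Trivial cofibration. The square \<open>\<Gamma>(\<gamma>)\<close> runs, through the initial segments of \<open>\<gamma>\<close>, from the
  constant path at the start of \<open>\<gamma>\<close> to \<open>\<gamma>\<close>, keeping the start fixed. So
  \<open>(x, \<gamma>) \<mapsto> (constant at x, \<Gamma>(\<gamma>))\<close> deforms \<open>j d\<^sub>0\<close> into the identity of \<open>b\<close>, and the deformation is
  constant on the image of \<open>j\<close> because \<open>\<Gamma>\<close> is compatible with \<open>c\<close> (lemma \<open>deformation\<close>). An inclusion
  with such a strong deformation retraction has the homotopy extension property for homotopies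
  written as paths: run the image of the deformation backwards, then follow the given homotopy on
  the retract (lemma \<open>deformation_retract_extension\<close>). On the image of \<open>j\<close> the first of the two
  paths is constant, and strictness of identities removes it. The adjunction turns paths into
  homotopies with respect to \<open>Cyl\<close>.\<close>

section \<open>Calculus of whiskering in a strict 2-category\<close>

context strict_2_category
begin

text \<open>The laws of a strict 2-category are restated with their typing hypotheses as membership in
  \<open>arr1\<close> or \<open>arr2\<close> and equations between sources and targets. In this form they contain no
  variables that the left-hand side does not determine, and the simplifier can discharge them.\<close>

lemma hom1D: "F \<in> hom1 C X Y \<Longrightarrow> F \<in> arr1 C \<and> src1 C F = X \<and> trg1 C F = Y"
  by (simp add: hom1_def)

lemma hom2D: "\<eta> \<in> hom2 C F G \<Longrightarrow> \<eta> \<in> arr2 C \<and> src2 C \<eta> = F \<and> trg2 C \<eta> = G"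
  by (simp add: hom2_def)

lemma hom1I: "\<lbrakk>F \<in> arr1 C; src1 C F = X; trg1 C F = Y\<rbrakk> \<Longrightarrow> F \<in> hom1 C X Y"
  by (simp add: hom1_def)

lemma hom2I: "\<lbrakk>\<eta> \<in> arr2 C; src2 C \<eta> = F; trg2 C \<eta> = G\<rbrakk> \<Longrightarrow> \<eta> \<in> hom2 C F G"
  by (simp add: hom2_def)

lemma hom1_self: "F \<in> arr1 C \<Longrightarrow> F \<in> hom1 C (src1 C F) (trg1 C F)"
  by (simp add: hom1_def)

lemma hom2_self: "\<eta> \<in> arr2 C \<Longrightarrow> \<eta> \<in> hom2 C (src2 C \<eta>) (trg2 C \<eta>)"
  by (simp add: hom2_def)

lemma comp1_type [simp]:
  assumes "F \<in> arr1 C" "G \<in> arr1 C" "trg1 C F = src1 C G"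
  shows "G \<odot> F \<in> arr1 C" "src1 C (G \<odot> F) = src1 C F" "trg1 C (G \<odot> F) = trg1 C G"
  using comp1_hom[of F "src1 C F" "trg1 C F" G "trg1 C G"] assms by (auto simp: hom1_def)

lemma comp1_assoc_arr [simp]:
  assumes "F \<in> arr1 C" "G \<in> arr1 C" "H \<in> arr1 C" "trg1 C F = src1 C G" "trg1 C G = src1 C H"
  shows "(H \<odot> G) \<odot> F = H \<odot> (G \<odot> F)"
  using comp1_assoc[of F "src1 C F" "trg1 C F" G "trg1 C G" H "trg1 C H"] assms
  by (auto simp: hom1_def)

lemma id1_type [simp]:
  assumes "X \<in> obj C"
  shows "id1 C X \<in> arr1 C" "src1 C (id1 C X) = X" "trg1 C (id1 C X) = X"
  using id1_hom[OF assms] by (auto simp: hom1_def)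

lemma comp1_id1 [simp]:
  assumes "F \<in> arr1 C"
  shows "trg1 C F = Y \<Longrightarrow> id1 C Y \<odot> F = F" "src1 C F = X \<Longrightarrow> F \<odot> id1 C X = F"
  using comp1_id_left[OF hom1_self[OF assms]] comp1_id_right[OF hom1_self[OF assms]] by auto

lemma boundary_type [simp]:
  assumes "\<eta> \<in> arr2 C"
  shows "src2 C \<eta> \<in> arr1 C" "trg2 C \<eta> \<in> arr1 C"
    "src1 C (trg2 C \<eta>) = src1 C (src2 C \<eta>)" "trg1 C (trg2 C \<eta>) = trg1 C (src2 C \<eta>)"
  using assms src2_arr1 trg2_arr1 src1_parallel trg1_parallel by auto

lemma id2_type [simp]:
  assumes "F \<in> arr1 C"
  shows "id2 C F \<in> arr2 C" "src2 C (id2 C F) = F" "trg2 C (id2 C F) = F"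
  using id2_hom[OF assms] by (auto simp: hom2_def)

lemma vcomp_type [simp]:
  assumes "\<eta> \<in> arr2 C" "\<theta> \<in> arr2 C" "trg2 C \<eta> = src2 C \<theta>"
  shows "\<theta> \<cdot> \<eta> \<in> arr2 C" "src2 C (\<theta> \<cdot> \<eta>) = src2 C \<eta>" "trg2 C (\<theta> \<cdot> \<eta>) = trg2 C \<theta>"
  using vcomp_hom[of \<eta> "src2 C \<eta>" "trg2 C \<eta>" \<theta> "trg2 C \<theta>"] assms by (auto simp: hom2_def)

lemma vcomp_assoc_arr [simp]:
  assumes "\<eta> \<in> arr2 C" "\<theta> \<in> arr2 C" "\<zeta> \<in> arr2 C" "trg2 C \<eta> = src2 C \<theta>" "trg2 C \<theta> = src2 C \<zeta>"
  shows "(\<zeta> \<cdot> \<theta>) \<cdot> \<eta> = \<zeta> \<cdot> (\<theta> \<cdot> \<eta>)"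
  using vcomp_assoc[of \<eta> "src2 C \<eta>" "trg2 C \<eta>" \<theta> "trg2 C \<theta>" \<zeta> "trg2 C \<zeta>"] assms
  by (auto simp: hom2_def)

lemma vcomp_id2 [simp]:
  assumes "\<eta> \<in> arr2 C"
  shows "trg2 C \<eta> = G \<Longrightarrow> id2 C G \<cdot> \<eta> = \<eta>" "src2 C \<eta> = F \<Longrightarrow> \<eta> \<cdot> id2 C F = \<eta>"
  using vcomp_id_left[OF hom2_self[OF assms]] vcomp_id_right[OF hom2_self[OF assms]] by auto

text \<open>Since composites are normalised to the right, an equation \<open>\<theta> \<cdot> \<eta> = \<zeta>\<close> is mostly needed for the
  first two factors of a longer composite.\<close>

lemma vcomp_tail:
  assumes "\<theta> \<cdot> \<eta> = \<zeta>" "\<eta> \<in> arr2 C" "\<theta> \<in> arr2 C" "trg2 C \<eta> = src2 C \<theta>"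
    "x \<in> arr2 C" "trg2 C x = src2 C \<eta>"
  shows "\<theta> \<cdot> (\<eta> \<cdot> x) = \<zeta> \<cdot> x"
  using assms vcomp_assoc_arr by metis

lemma lwhisker_type [simp]:
  assumes "\<eta> \<in> arr2 C" "F \<in> arr1 C" "trg1 C (src2 C \<eta>) = src1 C F"
  shows "F \<triangleright> \<eta> \<in> arr2 C" "src2 C (F \<triangleright> \<eta>) = F \<odot> src2 C \<eta>" "trg2 C (F \<triangleright> \<eta>) = F \<odot> trg2 C \<eta>"
  using hcomp_hom[of "src2 C \<eta>" "src1 C (src2 C \<eta>)" "src1 C F" F "trg1 C F" \<eta> "trg2 C \<eta>" "id2 C F" F]
    assms by (auto simp: hom1_def hom2_def lwhisker_def)

lemma rwhisker_type [simp]: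
  assumes "\<eta> \<in> arr2 C" "F \<in> arr1 C" "trg1 C F = src1 C (src2 C \<eta>)"
  shows "\<eta> \<triangleleft> F \<in> arr2 C" "src2 C (\<eta> \<triangleleft> F) = src2 C \<eta> \<odot> F" "trg2 C (\<eta> \<triangleleft> F) = trg2 C \<eta> \<odot> F"
  using hcomp_hom[of F "src1 C F" "trg1 C F" "src2 C \<eta>" "trg1 C (src2 C \<eta>)" "id2 C F" F \<eta> "trg2 C \<eta>"]
    assms by (auto simp: hom1_def hom2_def rwhisker_def)

text \<open>The two ways of resolving a horizontal composite into whiskerings; comparing them gives
  naturality of 2-arrows.\<close>

lemma hcomp_split:
  assumes "\<eta> \<in> arr2 C" "\<theta> \<in> arr2 C" "trg1 C (src2 C \<eta>) = src1 C (src2 C \<theta>)"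
  shows "\<theta> \<star> \<eta> = (\<theta> \<triangleleft> trg2 C \<eta>) \<cdot> (src2 C \<theta> \<triangleright> \<eta>)"
    and "\<theta> \<star> \<eta> = (trg2 C \<theta> \<triangleright> \<eta>) \<cdot> (\<theta> \<triangleleft> src2 C \<eta>)"
  using interchange[of "src2 C \<eta>" "src1 C (src2 C \<eta>)" "trg1 C (src2 C \<eta>)"
      "src2 C \<theta>" "trg1 C (src2 C \<theta>)" \<eta> "trg2 C \<eta>" "id2 C (trg2 C \<eta>)" "trg2 C \<eta>"
      "id2 C (src2 C \<theta>)" "src2 C \<theta>" \<theta> "trg2 C \<theta>"]
    interchange[of "src2 C \<eta>" "src1 C (src2 C \<eta>)" "trg1 C (src2 C \<eta>)"
      "src2 C \<theta>" "trg1 C (src2 C \<theta>)" "id2 C (src2 C \<eta>)" "src2 C \<eta>" \<eta> "trg2 C \<eta>"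
      \<theta> "trg2 C \<theta>" "id2 C (trg2 C \<theta>)" "trg2 C \<theta>"]
    assms by (auto simp: hom1_def hom2_def rwhisker_def lwhisker_def)

lemma whisker_natural:
  assumes "\<eta> \<in> hom2 C F G" "x \<in> hom2 C a b" "trg1 C a = src1 C F"
  shows "(\<eta> \<triangleleft> b) \<cdot> (F \<triangleright> x) = (G \<triangleright> x) \<cdot> (\<eta> \<triangleleft> a)"
  using hcomp_split[of x \<eta>] assms by (auto simp: hom2_def)

lemma lwhisker_vcomp [simp]:
  assumes "\<eta> \<in> arr2 C" "\<theta> \<in> arr2 C" "trg2 C \<eta> = src2 C \<theta>" "F \<in> arr1 C" "trg1 C (src2 C \<eta>) = src1 C F"
  shows "F \<triangleright> (\<theta> \<cdot> \<eta>) = (F \<triangleright> \<theta>) \<cdot> (F \<triangleright> \<eta>)"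
  using interchange[of "src2 C \<eta>" "src1 C (src2 C \<eta>)" "src1 C F" F "trg1 C F"
      \<eta> "trg2 C \<eta>" \<theta> "trg2 C \<theta>" "id2 C F" F "id2 C F" F] assms
  by (auto simp: hom1_def hom2_def lwhisker_def)

lemma rwhisker_vcomp [simp]:
  assumes "\<eta> \<in> arr2 C" "\<theta> \<in> arr2 C" "trg2 C \<eta> = src2 C \<theta>" "F \<in> arr1 C" "trg1 C F = src1 C (src2 C \<eta>)"
  shows "(\<theta> \<cdot> \<eta>) \<triangleleft> F = (\<theta> \<triangleleft> F) \<cdot> (\<eta> \<triangleleft> F)"
  using interchange[of F "src1 C F" "trg1 C F" "src2 C \<eta>" "trg1 C (src2 C \<eta>)"
      "id2 C F" F "id2 C F" F \<eta> "trg2 C \<eta>" \<theta> "trg2 C \<theta>"] assms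
  by (auto simp: hom1_def hom2_def rwhisker_def)

lemma whisker_id2 [simp]:
  assumes "F \<in> arr1 C" "G \<in> arr1 C" "trg1 C F = src1 C G"
  shows "G \<triangleright> id2 C F = id2 C (G \<odot> F)" "id2 C G \<triangleleft> F = id2 C (G \<odot> F)"
  using hcomp_id2[of F "src1 C F" "trg1 C F" G "trg1 C G"] assms
  by (auto simp: hom1_def lwhisker_def rwhisker_def)

lemma id1_lwhisker [simp]:
  assumes "\<eta> \<in> arr2 C" "trg1 C (src2 C \<eta>) = Y"
  shows "id1 C Y \<triangleright> \<eta> = \<eta>"
  using hcomp_id_left[of "src2 C \<eta>" "src1 C (src2 C \<eta>)" Y \<eta> "trg2 C \<eta>"] assms
  by (auto simp: hom1_def hom2_def lwhisker_def)

lemma rwhisker_rwhisker [simp]: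
  assumes "\<eta> \<in> arr2 C" "F \<in> arr1 C" "G \<in> arr1 C" "trg1 C F = src1 C G"
    "trg1 C G = src1 C (src2 C \<eta>)"
  shows "\<eta> \<triangleleft> G \<triangleleft> F = \<eta> \<triangleleft> (G \<odot> F)"
  using hcomp_assoc[of F "src1 C F" "trg1 C F" G "trg1 C G" "src2 C \<eta>" "trg1 C (src2 C \<eta>)"
      "id2 C F" F "id2 C G" G \<eta> "trg2 C \<eta>"]
    hcomp_id2[of F "src1 C F" "trg1 C F" G "trg1 C G"] assms
  by (auto simp: hom1_def hom2_def rwhisker_def)

lemma lwhisker_rwhisker [simp]:
  assumes "\<eta> \<in> arr2 C" "F \<in> arr1 C" "G \<in> arr1 C" "trg1 C F = src1 C (src2 C \<eta>)"
    "trg1 C (src2 C \<eta>) = src1 C G"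
  shows "(G \<triangleright> \<eta>) \<triangleleft> F = G \<triangleright> (\<eta> \<triangleleft> F)"
  using hcomp_assoc[of F "src1 C F" "trg1 C F" "src2 C \<eta>" "trg1 C (src2 C \<eta>)" G "trg1 C G"
      "id2 C F" F \<eta> "trg2 C \<eta>" "id2 C G" G] assms
  by (auto simp: hom1_def hom2_def rwhisker_def lwhisker_def)

lemma lwhisker_lwhisker:
  assumes "\<eta> \<in> arr2 C" "F \<in> arr1 C" "G \<in> arr1 C" "trg1 C (src2 C \<eta>) = src1 C F"
    "trg1 C F = src1 C G"
  shows "(G \<odot> F) \<triangleright> \<eta> = G \<triangleright> (F \<triangleright> \<eta>)"
  using hcomp_assoc[of "src2 C \<eta>" "src1 C (src2 C \<eta>)" "src1 C F" F "trg1 C F" G "trg1 C G"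
      \<eta> "trg2 C \<eta>" "id2 C F" F "id2 C G" G]
    hcomp_id2[of F "src1 C F" "trg1 C F" G "trg1 C G"] assms
  by (auto simp: hom1_def hom2_def lwhisker_def)

section \<open>Pullback squares\<close>

text \<open>The corners of a pullback square are existentially quantified, but the arrows determine them;
  the next two lemmas recover the universal property for the actual corners.\<close>

lemma pullback_lift:
  assumes "pullback_square C X Y p q f g" "W \<in> hom1 C X Y" "p \<in> hom2 C P B" "q \<in> hom2 C P D"
    "u \<in> hom2 C W B" "w \<in> hom2 C W D" "f \<cdot> u = g \<cdot> w"
  obtains t where "t \<in> hom2 C W P" "p \<cdot> t = u" "q \<cdot> t = w"
proof -
  obtain P' B' D' where *: "p \<in> hom2 C P' B'" "q \<in> hom2 C P' D'"
    and ex: "\<forall>W \<in> hom1 C X Y. \<forall>u \<in> hom2 C W B'. \<forall>w \<in> hom2 C W D'.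
      f \<cdot> u = g \<cdot> w \<longrightarrow> (\<exists>!t. t \<in> hom2 C W P' \<and> p \<cdot> t = u \<and> q \<cdot> t = w)"
    using assms(1) unfolding pullback_square_def by blast
  have eqs: "P' = P" "B' = B" "D' = D" using * assms by (auto simp: hom2_def)
  show thesis using ex[unfolded eqs] assms that by blast
qed

lemma pullback_joint_mono:
  assumes "pullback_square C X Y p q f g" "W \<in> hom1 C X Y"
    "t \<in> hom2 C W (src2 C p)" "t' \<in> hom2 C W (src2 C p)" "p \<cdot> t = p \<cdot> t'" "q \<cdot> t = q \<cdot> t'"
  shows "t = t'"
proof -
  obtain P B D E where *: "p \<in> hom2 C P B" "q \<in> hom2 C P D" "f \<in> hom2 C B E" "g \<in> hom2 C D E"
    and comm: "f \<cdot> p = g \<cdot> q"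
    and ex: "\<forall>W \<in> hom1 C X Y. \<forall>u \<in> hom2 C W B. \<forall>w \<in> hom2 C W D.
      f \<cdot> u = g \<cdot> w \<longrightarrow> (\<exists>!t. t \<in> hom2 C W P \<and> p \<cdot> t = u \<and> q \<cdot> t = w)"
    using assms(1) unfolding pullback_square_def by blast
  have P: "src2 C p = P" using * by (simp add: hom2_def)
  have "f \<cdot> (p \<cdot> t) = (f \<cdot> p) \<cdot> t" "g \<cdot> (q \<cdot> t) = (g \<cdot> q) \<cdot> t"
    using * assms P by (auto simp: hom2_def)
  then have "f \<cdot> (p \<cdot> t) = g \<cdot> (q \<cdot> t)" by (simp add: comm)
  moreover have "p \<cdot> t \<in> hom2 C W B" "q \<cdot> t \<in> hom2 C W D" using * assms P by (auto simp: hom2_def)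
  ultimately have "\<exists>!x. x \<in> hom2 C W P \<and> p \<cdot> x = p \<cdot> t \<and> q \<cdot> x = q \<cdot> t"
    using ex assms(2) by blast
  then show ?thesis using assms P by metis
qed

lemma pullback_square_sym:
  assumes "pullback_square C X Y p q f g"
  shows "pullback_square C X Y q p g f"
proof -
  obtain P B D E where *: "P \<in> hom1 C X Y" "B \<in> hom1 C X Y" "D \<in> hom1 C X Y" "E \<in> hom1 C X Y"
      "p \<in> hom2 C P B" "q \<in> hom2 C P D" "f \<in> hom2 C B E" "g \<in> hom2 C D E" "f \<cdot> p = g \<cdot> q"
    and ex: "\<forall>W \<in> hom1 C X Y. \<forall>u \<in> hom2 C W B. \<forall>w \<in> hom2 C W D.
      f \<cdot> u = g \<cdot> w \<longrightarrow> (\<exists>!t. t \<in> hom2 C W P \<and> p \<cdot> t = u \<and> q \<cdot> t = w)"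
    using assms unfolding pullback_square_def by (elim bexE conjE)
  have ex': "\<exists>!t. t \<in> hom2 C W P \<and> q \<cdot> t = w \<and> p \<cdot> t = u"
    if W: "W \<in> hom1 C X Y" "w \<in> hom2 C W D" "u \<in> hom2 C W B" "g \<cdot> w = f \<cdot> u" for W w u
  proof -
    have "\<exists>!t. t \<in> hom2 C W P \<and> p \<cdot> t = u \<and> q \<cdot> t = w"
      using ex[rule_format, OF W(1,3,2) W(4)[symmetric]] .
    then show ?thesis by (simp only: conj_commute[of "p \<cdot> _ = u"])
  qed
  show ?thesis
    unfolding pullback_square_def
    by (rule bexI[of _ P] bexI[of _ D] bexI[of _ B] bexI[of _ E] conjI ballI impI ex' *
        *(9)[symmetric] | assumption)+
qed

lemma pullback_square_commutes: "pullback_square C X Y p q f g \<Longrightarrow> f \<cdot> p = g \<cdot> q"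
  unfolding pullback_square_def by (elim bexE conjE)

section \<open>Transposition along an adjunction\<close>

text \<open>Only the unit enters \<open>adj\<close>; its inverse is \<open>k \<mapsto> \<epsilon>(b) \<cdot> L(k)\<close>, by the two triangle identities.\<close>

lemma adjunction_transpose:
  assumes adjn: "adjunction C X Y L R \<eta> \<epsilon>" and a: "a \<in> hom1 C W X" and b: "b \<in> hom1 C W Y"
  shows adj_hom: "h \<in> hom2 C (L \<odot> a) b \<Longrightarrow> adj C R \<eta> a h \<in> hom2 C a (R \<odot> b)"
    and adj_surj: "k \<in> hom2 C a (R \<odot> b) \<Longrightarrow>
      (\<epsilon> \<triangleleft> b) \<cdot> (L \<triangleright> k) \<in> hom2 C (L \<odot> a) b \<and> adj C R \<eta> a ((\<epsilon> \<triangleleft> b) \<cdot> (L \<triangleright> k)) = k"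
    and adj_inj: "\<lbrakk>h \<in> hom2 C (L \<odot> a) b; h' \<in> hom2 C (L \<odot> a) b; adj C R \<eta> a h = adj C R \<eta> a h'\<rbrakk>
      \<Longrightarrow> h = h'"
    and adj_natural: "\<lbrakk>h \<in> hom2 C (L \<odot> a) b; a' \<in> hom1 C W X; u \<in> hom2 C a' a\<rbrakk>
      \<Longrightarrow> adj C R \<eta> a' (h \<cdot> (L \<triangleright> u)) = adj C R \<eta> a h \<cdot> u"
proof -
  have *: "L \<in> hom1 C X Y" "R \<in> hom1 C Y X" "\<eta> \<in> hom2 C (id1 C X) (R \<odot> L)"
    "\<epsilon> \<in> hom2 C (L \<odot> R) (id1 C Y)" and tri1: "(\<epsilon> \<triangleleft> L) \<cdot> (L \<triangleright> \<eta>) = id2 C L"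
    and tri2: "(R \<triangleright> \<epsilon>) \<cdot> (\<eta> \<triangleleft> R) = id2 C R"
    using adjn unfolding adjunction_def by blast+
  have XY [simp]: "X \<in> obj C" "Y \<in> obj C"
    using *(1) src1_obj trg1_obj unfolding hom1_def by blast+
  note [simp] = hom1D[OF a] hom1D[OF b] *(1,2)[THEN hom1D] *(3,4)[THEN hom2D]
  show "adj C R \<eta> a h \<in> hom2 C a (R \<odot> b)" if "h \<in> hom2 C (L \<odot> a) b" for h
    using hom2D[OF that] by (auto simp: adj_def intro!: hom2I)
  have tri1a: "(\<epsilon> \<triangleleft> (L \<odot> a)) \<cdot> (L \<triangleright> (\<eta> \<triangleleft> a)) = id2 C (L \<odot> a)"
    using arg_cong[OF tri1, of "\<lambda>x. x \<triangleleft> a"] by simp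
  have tri2b: "(R \<triangleright> (\<epsilon> \<triangleleft> b)) \<cdot> (\<eta> \<triangleleft> (R \<odot> b)) = id2 C (R \<odot> b)"
    using arg_cong[OF tri2, of "\<lambda>x. x \<triangleleft> b"] by simp
  show "(\<epsilon> \<triangleleft> b) \<cdot> (L \<triangleright> k) \<in> hom2 C (L \<odot> a) b \<and> adj C R \<eta> a ((\<epsilon> \<triangleleft> b) \<cdot> (L \<triangleright> k)) = k"
    if k: "k \<in> hom2 C a (R \<odot> b)" for k
  proof
    note [simp] = hom2D[OF k]
    show "(\<epsilon> \<triangleleft> b) \<cdot> (L \<triangleright> k) \<in> hom2 C (L \<odot> a) b" by (auto intro!: hom2I)
    have "adj C R \<eta> a ((\<epsilon> \<triangleleft> b) \<cdot> (L \<triangleright> k)) = (R \<triangleright> (\<epsilon> \<triangleleft> b)) \<cdot> (((R \<odot> L) \<triangleright> k) \<cdot> (\<eta> \<triangleleft> a))"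
      by (simp add: adj_def lwhisker_lwhisker)
    also have "\<dots> = (R \<triangleright> (\<epsilon> \<triangleleft> b)) \<cdot> ((\<eta> \<triangleleft> (R \<odot> b)) \<cdot> k)"
      using whisker_natural[OF *(3) k] by simp
    also have "\<dots> = k"
      using vcomp_tail[OF tri2b, of k] by simp
    finally show "adj C R \<eta> a ((\<epsilon> \<triangleleft> b) \<cdot> (L \<triangleright> k)) = k" .
  qed
  have inv: "(\<epsilon> \<triangleleft> b) \<cdot> (L \<triangleright> adj C R \<eta> a h) = h" if h: "h \<in> hom2 C (L \<odot> a) b" for h
  proof -
    note [simp] = hom2D[OF h]
    have "(\<epsilon> \<triangleleft> b) \<cdot> (L \<triangleright> adj C R \<eta> a h) = (\<epsilon> \<triangleleft> b) \<cdot> (((L \<odot> R) \<triangleright> h) \<cdot> (L \<triangleright> (\<eta> \<triangleleft> a)))"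
      by (simp add: adj_def lwhisker_lwhisker)
    also have "\<dots> = h \<cdot> ((\<epsilon> \<triangleleft> (L \<odot> a)) \<cdot> (L \<triangleright> (\<eta> \<triangleleft> a)))"
      using vcomp_tail[OF whisker_natural[OF *(4) h], of "L \<triangleright> (\<eta> \<triangleleft> a)"] by simp
    also have "\<dots> = h" by (simp add: tri1a)
    finally show ?thesis .
  qed
  show "h = h'" if "h \<in> hom2 C (L \<odot> a) b" "h' \<in> hom2 C (L \<odot> a) b" "adj C R \<eta> a h = adj C R \<eta> a h'"
    for h h' using inv that by metis
  show "adj C R \<eta> a' (h \<cdot> (L \<triangleright> u)) = adj C R \<eta> a h \<cdot> u"
    if h: "h \<in> hom2 C (L \<odot> a) b" and a': "a' \<in> hom1 C W X" and u: "u \<in> hom2 C a' a" for h a' u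
  proof -
    note [simp] = hom1D[OF a'] hom2D[OF h] hom2D[OF u]
    have "adj C R \<eta> a' (h \<cdot> (L \<triangleright> u)) = (R \<triangleright> h) \<cdot> (((R \<odot> L) \<triangleright> u) \<cdot> (\<eta> \<triangleleft> a'))"
      by (simp add: adj_def lwhisker_lwhisker)
    also have "\<dots> = (R \<triangleright> h) \<cdot> ((\<eta> \<triangleleft> a) \<cdot> u)"
      using whisker_natural[OF *(3) u] by simp
    finally show ?thesis by (simp add: adj_def)
  qed
qed

end

section \<open>Structured co-cylinders evaluated at objects\<close>

locale structured_cocylinder = formal_category C one A
  for C :: "('o, 'm, 't, 'x) two_cells_scheme" (structure) and one A +
  fixes coCyl S :: 'm and e\<^sub>0 e\<^sub>1 c v r\<^sub>0 r\<^sub>1 s \<Gamma> :: 't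
  assumes cocyl: "cocylinder C A coCyl e\<^sub>0 e\<^sub>1"
    and contraction: "cocyl_contraction C A coCyl e\<^sub>0 e\<^sub>1 c"
    and involution: "involution C coCyl e\<^sub>0 e\<^sub>1 v" "involution_compatible C c v"
    and subdivision: "subdivision C A coCyl e\<^sub>0 e\<^sub>1 S r\<^sub>0 r\<^sub>1 s"
    and connection: "lower_right_connection C coCyl e\<^sub>0 e\<^sub>1 c \<Gamma>"
      "connection_compatible C coCyl c \<Gamma>"
    and strictness: "strictness_of_identities C coCyl e\<^sub>0 e\<^sub>1 c S r\<^sub>0 r\<^sub>1 s"
    and preserves: "preserves_mapping_cocylinders C one A coCyl e\<^sub>0"
begin

abbreviation object :: "'m \<Rightarrow> bool" where
  "object a \<equiv> a \<in> hom1 C one A"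

abbreviation ql :: 't where
  "ql \<equiv> q_left C coCyl e\<^sub>0 c S r\<^sub>0 r\<^sub>1"

abbreviation qr :: 't where
  "qr \<equiv> q_right C coCyl e\<^sub>1 c S r\<^sub>0 r\<^sub>1"

lemma object_type [simp]:
  assumes "object a"
  shows "a \<in> arr1 C" "src1 C a = one" "trg1 C a = A"
  using assms by (auto simp: hom1_def)

lemma coCyl_type [simp]: "coCyl \<in> arr1 C" "src1 C coCyl = A" "trg1 C coCyl = A"
  and S_type [simp]: "S \<in> arr1 C" "src1 C S = A" "trg1 C S = A"
proof -
  have "coCyl \<in> hom1 C A A" "S \<in> hom1 C A A"
    using cocyl subdivision unfolding cocylinder_def subdivision_def by blast+
  from this[THEN hom1D] show "coCyl \<in> arr1 C" "src1 C coCyl = A" "trg1 C coCyl = A"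
    "S \<in> arr1 C" "src1 C S = A" "trg1 C S = A" by blast+
qed

lemmas A_obj [simp]

lemma structure_type [simp]:
  "e\<^sub>0 \<in> arr2 C" "src2 C e\<^sub>0 = coCyl" "trg2 C e\<^sub>0 = id1 C A"
  "e\<^sub>1 \<in> arr2 C" "src2 C e\<^sub>1 = coCyl" "trg2 C e\<^sub>1 = id1 C A"
  "c \<in> arr2 C" "src2 C c = id1 C A" "trg2 C c = coCyl"
  "v \<in> arr2 C" "src2 C v = coCyl" "trg2 C v = coCyl"
  "r\<^sub>0 \<in> arr2 C" "src2 C r\<^sub>0 = S" "trg2 C r\<^sub>0 = coCyl"
  "r\<^sub>1 \<in> arr2 C" "src2 C r\<^sub>1 = S" "trg2 C r\<^sub>1 = coCyl"
  "s \<in> arr2 C" "src2 C s = S" "trg2 C s = coCyl"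
  "\<Gamma> \<in> arr2 C" "src2 C \<Gamma> = coCyl" "trg2 C \<Gamma> = coCyl \<odot> coCyl"
proof -
  have "e\<^sub>0 \<in> hom2 C coCyl (id1 C A)" "e\<^sub>1 \<in> hom2 C coCyl (id1 C A)"
    using cocyl unfolding cocylinder_def by blast+
  moreover have "c \<in> hom2 C (id1 C A) coCyl"
    using contraction unfolding cocyl_contraction_def by blast
  moreover have "v \<in> hom2 C coCyl coCyl"
    using involution(1) unfolding involution_def by blast
  moreover have "r\<^sub>0 \<in> hom2 C S coCyl" "r\<^sub>1 \<in> hom2 C S coCyl" "s \<in> hom2 C S coCyl"
    using subdivision unfolding subdivision_def by blast+
  moreover have "\<Gamma> \<in> hom2 C coCyl (coCyl \<odot> coCyl)"
    using connection(1) unfolding lower_right_connection_def by blast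
  ultimately show
    "e\<^sub>0 \<in> arr2 C" "src2 C e\<^sub>0 = coCyl" "trg2 C e\<^sub>0 = id1 C A"
    "e\<^sub>1 \<in> arr2 C" "src2 C e\<^sub>1 = coCyl" "trg2 C e\<^sub>1 = id1 C A"
    "c \<in> arr2 C" "src2 C c = id1 C A" "trg2 C c = coCyl"
    "v \<in> arr2 C" "src2 C v = coCyl" "trg2 C v = coCyl"
    "r\<^sub>0 \<in> arr2 C" "src2 C r\<^sub>0 = S" "trg2 C r\<^sub>0 = coCyl"
    "r\<^sub>1 \<in> arr2 C" "src2 C r\<^sub>1 = S" "trg2 C r\<^sub>1 = coCyl"
    "s \<in> arr2 C" "src2 C s = S" "trg2 C s = coCyl"
    "\<Gamma> \<in> arr2 C" "src2 C \<Gamma> = coCyl" "trg2 C \<Gamma> = coCyl \<odot> coCyl"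
    unfolding hom2_def by blast+
qed

lemma object_comp [simp]:
  "object a \<Longrightarrow> object (coCyl \<odot> a)" "object a \<Longrightarrow> object (S \<odot> a)"
  by (auto intro: hom1I)

lemma S_pullback: "pullback_square C A A r\<^sub>0 r\<^sub>1 e\<^sub>0 e\<^sub>1"
  using subdivision unfolding subdivision_def by blast

lemma contraction_identities: "e\<^sub>0 \<cdot> c = id2 C (id1 C A)" "e\<^sub>1 \<cdot> c = id2 C (id1 C A)"
  using contraction unfolding cocyl_contraction_def by blast+

lemma ql_determined: "ql \<in> hom2 C coCyl S" "r\<^sub>0 \<cdot> ql = id2 C coCyl" "r\<^sub>1 \<cdot> ql = c \<cdot> e\<^sub>0"
proof -
  have cmp: "e\<^sub>0 \<cdot> id2 C coCyl = e\<^sub>1 \<cdot> (c \<cdot> e\<^sub>0)"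
    using vcomp_tail[OF contraction_identities(2), of e\<^sub>0] by simp
  obtain t where t: "t \<in> hom2 C coCyl S" "r\<^sub>0 \<cdot> t = id2 C coCyl" "r\<^sub>1 \<cdot> t = c \<cdot> e\<^sub>0"
    by (rule pullback_lift[OF S_pullback _ _ _ _ _ cmp, of coCyl S coCyl coCyl])
      (auto intro: hom1I hom2I)
  have "ql \<in> hom2 C coCyl S \<and> r\<^sub>0 \<cdot> ql = id2 C coCyl \<and> r\<^sub>1 \<cdot> ql = c \<cdot> e\<^sub>0"
    unfolding q_left_def
  proof (rule theI)
    fix t' assume "t' \<in> hom2 C coCyl S \<and> r\<^sub>0 \<cdot> t' = id2 C coCyl \<and> r\<^sub>1 \<cdot> t' = c \<cdot> e\<^sub>0"
    then show "t' = t"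
      using pullback_joint_mono[OF S_pullback hom1I, of coCyl t' t] t by auto
  qed (use t in auto)
  then show "ql \<in> hom2 C coCyl S" "r\<^sub>0 \<cdot> ql = id2 C coCyl" "r\<^sub>1 \<cdot> ql = c \<cdot> e\<^sub>0" by auto
qed

lemma qr_determined: "qr \<in> hom2 C coCyl S" "r\<^sub>0 \<cdot> qr = c \<cdot> e\<^sub>1" "r\<^sub>1 \<cdot> qr = id2 C coCyl"
proof -
  have cmp: "e\<^sub>0 \<cdot> (c \<cdot> e\<^sub>1) = e\<^sub>1 \<cdot> id2 C coCyl"
    using vcomp_tail[OF contraction_identities(1), of e\<^sub>1] by simp
  obtain t where t: "t \<in> hom2 C coCyl S" "r\<^sub>0 \<cdot> t = c \<cdot> e\<^sub>1" "r\<^sub>1 \<cdot> t = id2 C coCyl"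
    by (rule pullback_lift[OF S_pullback _ _ _ _ _ cmp, of coCyl S coCyl coCyl])
      (auto intro: hom1I hom2I)
  have "qr \<in> hom2 C coCyl S \<and> r\<^sub>0 \<cdot> qr = c \<cdot> e\<^sub>1 \<and> r\<^sub>1 \<cdot> qr = id2 C coCyl"
    unfolding q_right_def
  proof (rule theI)
    fix t' assume "t' \<in> hom2 C coCyl S \<and> r\<^sub>0 \<cdot> t' = c \<cdot> e\<^sub>1 \<and> r\<^sub>1 \<cdot> t' = id2 C coCyl"
    then show "t' = t"
      using pullback_joint_mono[OF S_pullback hom1I, of coCyl t' t] t by auto
  qed (use t in auto)
  then show "qr \<in> hom2 C coCyl S" "r\<^sub>0 \<cdot> qr = c \<cdot> e\<^sub>1" "r\<^sub>1 \<cdot> qr = id2 C coCyl" by auto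
qed

lemma q_type [simp]:
  "ql \<in> arr2 C" "src2 C ql = coCyl" "trg2 C ql = S"
  "qr \<in> arr2 C" "src2 C qr = coCyl" "trg2 C qr = S"
  using hom2D[OF ql_determined(1)] hom2D[OF qr_determined(1)] by blast+

lemma structure_identities:
  "e\<^sub>0 \<cdot> v = e\<^sub>1" "e\<^sub>1 \<cdot> v = e\<^sub>0" "v \<cdot> c = c"
  "e\<^sub>0 \<cdot> s = e\<^sub>0 \<cdot> r\<^sub>1" "e\<^sub>1 \<cdot> s = e\<^sub>1 \<cdot> r\<^sub>0" "e\<^sub>0 \<cdot> r\<^sub>0 = e\<^sub>1 \<cdot> r\<^sub>1"
  "s \<cdot> ql = id2 C coCyl" "s \<cdot> qr = id2 C coCyl"
  "(e\<^sub>1 \<triangleleft> coCyl) \<cdot> \<Gamma> = id2 C coCyl" "(coCyl \<triangleright> e\<^sub>1) \<cdot> \<Gamma> = id2 C coCyl"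
  "(e\<^sub>0 \<triangleleft> coCyl) \<cdot> \<Gamma> = c \<cdot> e\<^sub>0" "(coCyl \<triangleright> e\<^sub>0) \<cdot> \<Gamma> = c \<cdot> e\<^sub>0"
  "\<Gamma> \<cdot> c = (c \<triangleleft> coCyl) \<cdot> c"
  using involution subdivision strictness connection pullback_square_commutes[OF S_pullback]
  unfolding involution_def involution_compatible_def subdivision_def
    strictness_of_identities_def lower_right_connection_def connection_compatible_def
  by - (elim conjE, assumption)+

lemma eval_identities:
  assumes a: "object a"
  shows e\<^sub>0_c: "(e\<^sub>0 \<triangleleft> a) \<cdot> (c \<triangleleft> a) = id2 C a"
    and e\<^sub>1_c: "(e\<^sub>1 \<triangleleft> a) \<cdot> (c \<triangleleft> a) = id2 C a"
    and e\<^sub>0_v: "(e\<^sub>0 \<triangleleft> a) \<cdot> (v \<triangleleft> a) = e\<^sub>1 \<triangleleft> a"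
    and e\<^sub>1_v: "(e\<^sub>1 \<triangleleft> a) \<cdot> (v \<triangleleft> a) = e\<^sub>0 \<triangleleft> a"
    and v_c: "(v \<triangleleft> a) \<cdot> (c \<triangleleft> a) = c \<triangleleft> a"
    and e\<^sub>0_s: "(e\<^sub>0 \<triangleleft> a) \<cdot> (s \<triangleleft> a) = (e\<^sub>0 \<triangleleft> a) \<cdot> (r\<^sub>1 \<triangleleft> a)"
    and e\<^sub>1_s: "(e\<^sub>1 \<triangleleft> a) \<cdot> (s \<triangleleft> a) = (e\<^sub>1 \<triangleleft> a) \<cdot> (r\<^sub>0 \<triangleleft> a)"
    and e\<^sub>0_r\<^sub>0: "(e\<^sub>0 \<triangleleft> a) \<cdot> (r\<^sub>0 \<triangleleft> a) = (e\<^sub>1 \<triangleleft> a) \<cdot> (r\<^sub>1 \<triangleleft> a)"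
    and r\<^sub>0_ql: "(r\<^sub>0 \<triangleleft> a) \<cdot> (ql \<triangleleft> a) = id2 C (coCyl \<odot> a)"
    and r\<^sub>1_ql: "(r\<^sub>1 \<triangleleft> a) \<cdot> (ql \<triangleleft> a) = (c \<triangleleft> a) \<cdot> (e\<^sub>0 \<triangleleft> a)"
    and s_ql: "(s \<triangleleft> a) \<cdot> (ql \<triangleleft> a) = id2 C (coCyl \<odot> a)"
    and r\<^sub>0_qr: "(r\<^sub>0 \<triangleleft> a) \<cdot> (qr \<triangleleft> a) = (c \<triangleleft> a) \<cdot> (e\<^sub>1 \<triangleleft> a)"
    and r\<^sub>1_qr: "(r\<^sub>1 \<triangleleft> a) \<cdot> (qr \<triangleleft> a) = id2 C (coCyl \<odot> a)"
    and s_qr: "(s \<triangleleft> a) \<cdot> (qr \<triangleleft> a) = id2 C (coCyl \<odot> a)"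
    and e\<^sub>1_\<Gamma>: "(e\<^sub>1 \<triangleleft> (coCyl \<odot> a)) \<cdot> (\<Gamma> \<triangleleft> a) = id2 C (coCyl \<odot> a)"
    and Pe\<^sub>1_\<Gamma>: "(coCyl \<triangleright> (e\<^sub>1 \<triangleleft> a)) \<cdot> (\<Gamma> \<triangleleft> a) = id2 C (coCyl \<odot> a)"
    and e\<^sub>0_\<Gamma>: "(e\<^sub>0 \<triangleleft> (coCyl \<odot> a)) \<cdot> (\<Gamma> \<triangleleft> a) = (c \<triangleleft> a) \<cdot> (e\<^sub>0 \<triangleleft> a)"
    and Pe\<^sub>0_\<Gamma>: "(coCyl \<triangleright> (e\<^sub>0 \<triangleleft> a)) \<cdot> (\<Gamma> \<triangleleft> a) = (c \<triangleleft> a) \<cdot> (e\<^sub>0 \<triangleleft> a)"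
    and \<Gamma>_c: "(\<Gamma> \<triangleleft> a) \<cdot> (c \<triangleleft> a) = (c \<triangleleft> (coCyl \<odot> a)) \<cdot> (c \<triangleleft> a)"
proof -
  have ev: "(y \<triangleleft> a) \<cdot> (x \<triangleleft> a) = z \<triangleleft> a"
    if "y \<cdot> x = z" "x \<in> arr2 C" "y \<in> arr2 C" "trg2 C x = src2 C y" "trg1 C a = src1 C (src2 C x)"
    for x y z
    using that a by (metis rwhisker_vcomp object_type(1))
  show "(e\<^sub>0 \<triangleleft> a) \<cdot> (c \<triangleleft> a) = id2 C a"
    using ev[OF contraction_identities(1)] a by simp
  show "(e\<^sub>1 \<triangleleft> a) \<cdot> (c \<triangleleft> a) = id2 C a"
    using ev[OF contraction_identities(2)] a by simp
  show "(e\<^sub>0 \<triangleleft> a) \<cdot> (v \<triangleleft> a) = e\<^sub>1 \<triangleleft> a"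
    using ev[OF structure_identities(1)] a by simp
  show "(e\<^sub>1 \<triangleleft> a) \<cdot> (v \<triangleleft> a) = e\<^sub>0 \<triangleleft> a"
    using ev[OF structure_identities(2)] a by simp
  show "(v \<triangleleft> a) \<cdot> (c \<triangleleft> a) = c \<triangleleft> a"
    using ev[OF structure_identities(3)] a by simp
  show "(e\<^sub>0 \<triangleleft> a) \<cdot> (s \<triangleleft> a) = (e\<^sub>0 \<triangleleft> a) \<cdot> (r\<^sub>1 \<triangleleft> a)"
    using ev[OF structure_identities(4)] a by simp
  show "(e\<^sub>1 \<triangleleft> a) \<cdot> (s \<triangleleft> a) = (e\<^sub>1 \<triangleleft> a) \<cdot> (r\<^sub>0 \<triangleleft> a)"
    using ev[OF structure_identities(5)] a by simp
  show "(e\<^sub>0 \<triangleleft> a) \<cdot> (r\<^sub>0 \<triangleleft> a) = (e\<^sub>1 \<triangleleft> a) \<cdot> (r\<^sub>1 \<triangleleft> a)"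
    using ev[OF structure_identities(6)] a by simp
  show "(r\<^sub>0 \<triangleleft> a) \<cdot> (ql \<triangleleft> a) = id2 C (coCyl \<odot> a)"
    using ev[OF ql_determined(2)] a by simp
  show "(r\<^sub>1 \<triangleleft> a) \<cdot> (ql \<triangleleft> a) = (c \<triangleleft> a) \<cdot> (e\<^sub>0 \<triangleleft> a)"
    using ev[OF ql_determined(3)] a by simp
  show "(s \<triangleleft> a) \<cdot> (ql \<triangleleft> a) = id2 C (coCyl \<odot> a)"
    using ev[OF structure_identities(7)] a by simp
  show "(r\<^sub>0 \<triangleleft> a) \<cdot> (qr \<triangleleft> a) = (c \<triangleleft> a) \<cdot> (e\<^sub>1 \<triangleleft> a)"
    using ev[OF qr_determined(2)] a by simp
  show "(r\<^sub>1 \<triangleleft> a) \<cdot> (qr \<triangleleft> a) = id2 C (coCyl \<odot> a)"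
    using ev[OF qr_determined(3)] a by simp
  show "(s \<triangleleft> a) \<cdot> (qr \<triangleleft> a) = id2 C (coCyl \<odot> a)"
    using ev[OF structure_identities(8)] a by simp
  show "(e\<^sub>1 \<triangleleft> (coCyl \<odot> a)) \<cdot> (\<Gamma> \<triangleleft> a) = id2 C (coCyl \<odot> a)"
    using ev[OF structure_identities(9)] a by simp
  show "(coCyl \<triangleright> (e\<^sub>1 \<triangleleft> a)) \<cdot> (\<Gamma> \<triangleleft> a) = id2 C (coCyl \<odot> a)"
    using ev[OF structure_identities(10)] a by simp
  show "(e\<^sub>0 \<triangleleft> (coCyl \<odot> a)) \<cdot> (\<Gamma> \<triangleleft> a) = (c \<triangleleft> a) \<cdot> (e\<^sub>0 \<triangleleft> a)"
    using ev[OF structure_identities(11)] a by simp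
  show "(coCyl \<triangleright> (e\<^sub>0 \<triangleleft> a)) \<cdot> (\<Gamma> \<triangleleft> a) = (c \<triangleleft> a) \<cdot> (e\<^sub>0 \<triangleleft> a)"
    using ev[OF structure_identities(12)] a by simp
  show "(\<Gamma> \<triangleleft> a) \<cdot> (c \<triangleleft> a) = (c \<triangleleft> (coCyl \<odot> a)) \<cdot> (c \<triangleleft> a)"
    using ev[OF structure_identities(13)] a by simp
qed

lemma eval_natural:
  assumes "object a" "x \<in> hom2 C a a'"
  shows e\<^sub>0_natural: "(e\<^sub>0 \<triangleleft> a') \<cdot> (coCyl \<triangleright> x) = x \<cdot> (e\<^sub>0 \<triangleleft> a)"
    and e\<^sub>1_natural: "(e\<^sub>1 \<triangleleft> a') \<cdot> (coCyl \<triangleright> x) = x \<cdot> (e\<^sub>1 \<triangleleft> a)"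
    and c_natural: "(coCyl \<triangleright> x) \<cdot> (c \<triangleleft> a) = (c \<triangleleft> a') \<cdot> x"
  using whisker_natural[OF hom2_self[of e\<^sub>0] assms(2)] whisker_natural[OF hom2_self[of e\<^sub>1] assms(2)]
    whisker_natural[OF hom2_self[of c] assms(2)]
    assms hom2D[OF assms(2)] by auto

lemma S_eval_pullback:
  assumes "object a"
  shows "pullback_square C one A (r\<^sub>0 \<triangleleft> a) (r\<^sub>1 \<triangleleft> a) (e\<^sub>0 \<triangleleft> a) (e\<^sub>1 \<triangleleft> a)"
  using eval_pullback[OF _ _ assms S_pullback] by simp

text \<open>\<open>S(a)\<close> is a mapping co-cylinder of \<open>e\<^sub>1(a)\<close>, so the hypothesis on mapping co-cylinders also lets
  \<open>coCyl\<close> preserve the pullback that defines subdivision.\<close>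

lemma P_S_pullback:
  assumes a: "object a"
  shows "pullback_square C one A (coCyl \<triangleright> (r\<^sub>1 \<triangleleft> a)) (coCyl \<triangleright> (r\<^sub>0 \<triangleleft> a))
    (coCyl \<triangleright> (e\<^sub>1 \<triangleleft> a)) (coCyl \<triangleright> (e\<^sub>0 \<triangleleft> a))"
proof -
  have "mapping_cocylinder C one A coCyl e\<^sub>0 (coCyl \<odot> a) a (e\<^sub>1 \<triangleleft> a) (S \<odot> a) (r\<^sub>1 \<triangleleft> a) (r\<^sub>0 \<triangleleft> a)"
    unfolding mapping_cocylinder_def
    using a pullback_square_sym[OF S_eval_pullback[OF a]] by (auto intro: hom2I)
  moreover have "e\<^sub>1 \<triangleleft> a \<in> hom2 C (coCyl \<odot> a) a" using a by (auto intro: hom2I)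
  ultimately show ?thesis
    using preserves a unfolding preserves_mapping_cocylinders_def by (meson object_comp(1))
qed

section \<open>Growing a path along a composable one\<close>

text \<open>For a composable pair, \<open>\<gamma>\<close> given by \<open>r\<^sub>1\<close> and then \<open>h\<close> given by \<open>r\<^sub>0\<close>, the square \<open>\<sigma>\<close> is the path
  from \<open>\<gamma>\<close> to the concatenation of \<open>\<gamma>\<close> and \<open>h\<close> whose start points stay fixed and whose end points
  trace out \<open>h\<close>. It is the concatenation, in the inner direction, of \<open>c(\<gamma>)\<close> with \<open>\<Gamma>(h)\<close>, that is,
  \<open>P(s)\<close> applied to the pair \<open>t\<close> of these. Its initial path is \<open>\<gamma>\<close> followed by a constant path, which is
  \<open>\<gamma>\<close> by strictness of identities. The last property is the case of a constant \<open>h\<close>.\<close>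

lemma connection_square:
  assumes a: "object a"
  obtains \<sigma> where "\<sigma> \<in> hom2 C (S \<odot> a) (coCyl \<odot> (coCyl \<odot> a))"
    "(e\<^sub>0 \<triangleleft> (coCyl \<odot> a)) \<cdot> \<sigma> = r\<^sub>1 \<triangleleft> a"
    "(coCyl \<triangleright> (e\<^sub>0 \<triangleleft> a)) \<cdot> \<sigma> = (c \<triangleleft> a) \<cdot> ((e\<^sub>0 \<triangleleft> a) \<cdot> (r\<^sub>1 \<triangleleft> a))"
    "(coCyl \<triangleright> (e\<^sub>1 \<triangleleft> a)) \<cdot> \<sigma> = r\<^sub>0 \<triangleleft> a"
    "\<sigma> \<cdot> (qr \<triangleleft> a) = c \<triangleleft> (coCyl \<odot> a)"
proof -
  note [simp] = a
  have hom: "r\<^sub>0 \<triangleleft> a \<in> hom2 C (S \<odot> a) (coCyl \<odot> a)" "r\<^sub>1 \<triangleleft> a \<in> hom2 C (S \<odot> a) (coCyl \<odot> a)"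
    "s \<triangleleft> a \<in> hom2 C (S \<odot> a) (coCyl \<odot> a)" "qr \<triangleleft> a \<in> hom2 C (coCyl \<odot> a) (S \<odot> a)"
    "c \<triangleleft> a \<in> hom2 C a (coCyl \<odot> a)" "e\<^sub>0 \<triangleleft> a \<in> hom2 C (coCyl \<odot> a) a" "e\<^sub>1 \<triangleleft> a \<in> hom2 C (coCyl \<odot> a) a"
    by (auto intro: hom2I)
  have Sa: "object (S \<odot> a)" and Pa: "object (coCyl \<odot> a)" by simp_all
  have "(coCyl \<triangleright> (e\<^sub>1 \<triangleleft> a)) \<cdot> ((c \<triangleleft> (coCyl \<odot> a)) \<cdot> (r\<^sub>1 \<triangleleft> a)) = (c \<triangleleft> a) \<cdot> ((e\<^sub>1 \<triangleleft> a) \<cdot> (r\<^sub>1 \<triangleleft> a))"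
    using vcomp_tail[OF c_natural[OF Pa hom(7)], of "r\<^sub>1 \<triangleleft> a"] by simp
  also have "\<dots> = (coCyl \<triangleright> (e\<^sub>0 \<triangleleft> a)) \<cdot> ((\<Gamma> \<triangleleft> a) \<cdot> (r\<^sub>0 \<triangleleft> a))"
    using vcomp_tail[OF Pe\<^sub>0_\<Gamma>[OF a], of "r\<^sub>0 \<triangleleft> a"] by (simp add: e\<^sub>0_r\<^sub>0)
  finally have compat: "(coCyl \<triangleright> (e\<^sub>1 \<triangleleft> a)) \<cdot> ((c \<triangleleft> (coCyl \<odot> a)) \<cdot> (r\<^sub>1 \<triangleleft> a))
    = (coCyl \<triangleright> (e\<^sub>0 \<triangleleft> a)) \<cdot> ((\<Gamma> \<triangleleft> a) \<cdot> (r\<^sub>0 \<triangleleft> a))" .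
  obtain t where t: "t \<in> hom2 C (S \<odot> a) (coCyl \<odot> (S \<odot> a))"
    and r\<^sub>1_t: "(coCyl \<triangleright> (r\<^sub>1 \<triangleleft> a)) \<cdot> t = (c \<triangleleft> (coCyl \<odot> a)) \<cdot> (r\<^sub>1 \<triangleleft> a)"
    and r\<^sub>0_t: "(coCyl \<triangleright> (r\<^sub>0 \<triangleleft> a)) \<cdot> t = (\<Gamma> \<triangleleft> a) \<cdot> (r\<^sub>0 \<triangleleft> a)"
    by (rule pullback_lift[OF P_S_pullback[OF a] Sa _ _ _ _ compat, of "coCyl \<odot> (S \<odot> a)"
          "coCyl \<odot> (coCyl \<odot> a)" "coCyl \<odot> (coCyl \<odot> a)"]) (auto intro: hom2I)
  have t_type [simp]: "t \<in> arr2 C" "src2 C t = S \<odot> a" "trg2 C t = coCyl \<odot> (S \<odot> a)"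
    using hom2D[OF t] by auto
  \<comment> \<open>The pair at the start of \<open>t\<close> is \<open>\<gamma>\<close> followed by the constant path at its end.\<close>
  have "(e\<^sub>0 \<triangleleft> (S \<odot> a)) \<cdot> t = (qr \<triangleleft> a) \<cdot> (r\<^sub>1 \<triangleleft> a)"
  proof (rule pullback_joint_mono[OF S_eval_pullback[OF a] Sa])
    have "(r\<^sub>0 \<triangleleft> a) \<cdot> ((e\<^sub>0 \<triangleleft> (S \<odot> a)) \<cdot> t) = (e\<^sub>0 \<triangleleft> (coCyl \<odot> a)) \<cdot> ((coCyl \<triangleright> (r\<^sub>0 \<triangleleft> a)) \<cdot> t)"
      using vcomp_tail[OF e\<^sub>0_natural[OF Sa hom(1)], of t] by simp
    also have "\<dots> = (c \<triangleleft> a) \<cdot> ((e\<^sub>1 \<triangleleft> a) \<cdot> (r\<^sub>1 \<triangleleft> a))"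
      using vcomp_tail[OF e\<^sub>0_\<Gamma>[OF a], of "r\<^sub>0 \<triangleleft> a"] by (simp add: r\<^sub>0_t e\<^sub>0_r\<^sub>0)
    also have "\<dots> = (r\<^sub>0 \<triangleleft> a) \<cdot> ((qr \<triangleleft> a) \<cdot> (r\<^sub>1 \<triangleleft> a))"
      using vcomp_tail[OF r\<^sub>0_qr[OF a], of "r\<^sub>1 \<triangleleft> a"] by simp
    finally show "(r\<^sub>0 \<triangleleft> a) \<cdot> ((e\<^sub>0 \<triangleleft> (S \<odot> a)) \<cdot> t) = (r\<^sub>0 \<triangleleft> a) \<cdot> ((qr \<triangleleft> a) \<cdot> (r\<^sub>1 \<triangleleft> a))" .
    have "(r\<^sub>1 \<triangleleft> a) \<cdot> ((e\<^sub>0 \<triangleleft> (S \<odot> a)) \<cdot> t) = (e\<^sub>0 \<triangleleft> (coCyl \<odot> a)) \<cdot> ((coCyl \<triangleright> (r\<^sub>1 \<triangleleft> a)) \<cdot> t)"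
      using vcomp_tail[OF e\<^sub>0_natural[OF Sa hom(2)], of t] by simp
    also have "\<dots> = r\<^sub>1 \<triangleleft> a"
      using vcomp_tail[OF e\<^sub>0_c[OF Pa], of "r\<^sub>1 \<triangleleft> a"] by (simp add: r\<^sub>1_t)
    also have "\<dots> = (r\<^sub>1 \<triangleleft> a) \<cdot> ((qr \<triangleleft> a) \<cdot> (r\<^sub>1 \<triangleleft> a))"
      using vcomp_tail[OF r\<^sub>1_qr[OF a], of "r\<^sub>1 \<triangleleft> a"] by simp
    finally show "(r\<^sub>1 \<triangleleft> a) \<cdot> ((e\<^sub>0 \<triangleleft> (S \<odot> a)) \<cdot> t) = (r\<^sub>1 \<triangleleft> a) \<cdot> ((qr \<triangleleft> a) \<cdot> (r\<^sub>1 \<triangleleft> a))" .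
  qed (auto intro: hom2I)
  then have e\<^sub>0_t: "(e\<^sub>0 \<triangleleft> (S \<odot> a)) \<cdot> t = (qr \<triangleleft> a) \<cdot> (r\<^sub>1 \<triangleleft> a)" .
  \<comment> \<open>For constant \<open>h\<close> both components of \<open>t\<close> are degenerate in the outer direction.\<close>
  have t_qr: "t \<cdot> (qr \<triangleleft> a) = (coCyl \<triangleright> (qr \<triangleleft> a)) \<cdot> (c \<triangleleft> (coCyl \<odot> a))"
  proof (rule pullback_joint_mono[OF P_S_pullback[OF a] Pa])
    have "(coCyl \<triangleright> (r\<^sub>1 \<triangleleft> a)) \<cdot> (t \<cdot> (qr \<triangleleft> a)) = c \<triangleleft> (coCyl \<odot> a)"
      using vcomp_tail[OF r\<^sub>1_t, of "qr \<triangleleft> a"] by (simp add: r\<^sub>1_qr)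
    also have "\<dots> = (coCyl \<triangleright> ((r\<^sub>1 \<triangleleft> a) \<cdot> (qr \<triangleleft> a))) \<cdot> (c \<triangleleft> (coCyl \<odot> a))"
      unfolding r\<^sub>1_qr[OF a] by simp
    also have "\<dots> = (coCyl \<triangleright> (r\<^sub>1 \<triangleleft> a)) \<cdot> ((coCyl \<triangleright> (qr \<triangleleft> a)) \<cdot> (c \<triangleleft> (coCyl \<odot> a)))"
      by simp
    finally show "(coCyl \<triangleright> (r\<^sub>1 \<triangleleft> a)) \<cdot> (t \<cdot> (qr \<triangleleft> a))
      = (coCyl \<triangleright> (r\<^sub>1 \<triangleleft> a)) \<cdot> ((coCyl \<triangleright> (qr \<triangleleft> a)) \<cdot> (c \<triangleleft> (coCyl \<odot> a)))" .
    have "(coCyl \<triangleright> (r\<^sub>0 \<triangleleft> a)) \<cdot> (t \<cdot> (qr \<triangleleft> a)) = (c \<triangleleft> (coCyl \<odot> a)) \<cdot> ((c \<triangleleft> a) \<cdot> (e\<^sub>1 \<triangleleft> a))"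
      using vcomp_tail[OF r\<^sub>0_t, of "qr \<triangleleft> a"] vcomp_tail[OF \<Gamma>_c[OF a], of "e\<^sub>1 \<triangleleft> a"]
      by (simp add: r\<^sub>0_qr)
    also have "\<dots> = (coCyl \<triangleright> (c \<triangleleft> a)) \<cdot> ((coCyl \<triangleright> (e\<^sub>1 \<triangleleft> a)) \<cdot> (c \<triangleleft> (coCyl \<odot> a)))"
      using vcomp_tail[OF c_natural[OF a hom(5)], of "e\<^sub>1 \<triangleleft> a"]
      by (simp add: c_natural[OF Pa hom(7)])
    also have "\<dots> = (coCyl \<triangleright> ((c \<triangleleft> a) \<cdot> (e\<^sub>1 \<triangleleft> a))) \<cdot> (c \<triangleleft> (coCyl \<odot> a))"
      by simp
    also have "\<dots> = (coCyl \<triangleright> (r\<^sub>0 \<triangleleft> a)) \<cdot> ((coCyl \<triangleright> (qr \<triangleleft> a)) \<cdot> (c \<triangleleft> (coCyl \<odot> a)))"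
      unfolding r\<^sub>0_qr[OF a, symmetric] by simp
    finally show "(coCyl \<triangleright> (r\<^sub>0 \<triangleleft> a)) \<cdot> (t \<cdot> (qr \<triangleleft> a))
      = (coCyl \<triangleright> (r\<^sub>0 \<triangleleft> a)) \<cdot> ((coCyl \<triangleright> (qr \<triangleleft> a)) \<cdot> (c \<triangleleft> (coCyl \<odot> a)))" .
  qed (auto intro: hom2I)
  let ?\<sigma> = "(coCyl \<triangleright> (s \<triangleleft> a)) \<cdot> t"
  show thesis
  proof
    show "?\<sigma> \<in> hom2 C (S \<odot> a) (coCyl \<odot> (coCyl \<odot> a))" by (auto intro: hom2I)
    have "(e\<^sub>0 \<triangleleft> (coCyl \<odot> a)) \<cdot> ?\<sigma> = (s \<triangleleft> a) \<cdot> ((qr \<triangleleft> a) \<cdot> (r\<^sub>1 \<triangleleft> a))"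
      using vcomp_tail[OF e\<^sub>0_natural[OF Sa hom(3)], of t] by (simp add: e\<^sub>0_t)
    also have "\<dots> = r\<^sub>1 \<triangleleft> a"
      using vcomp_tail[OF s_qr[OF a], of "r\<^sub>1 \<triangleleft> a"] by simp
    finally show "(e\<^sub>0 \<triangleleft> (coCyl \<odot> a)) \<cdot> ?\<sigma> = r\<^sub>1 \<triangleleft> a" .
    have "(coCyl \<triangleright> (e\<^sub>0 \<triangleleft> a)) \<cdot> ?\<sigma> = (coCyl \<triangleright> ((e\<^sub>0 \<triangleleft> a) \<cdot> (s \<triangleleft> a))) \<cdot> t" by simp
    also have "\<dots> = (coCyl \<triangleright> (e\<^sub>0 \<triangleleft> a)) \<cdot> ((coCyl \<triangleright> (r\<^sub>1 \<triangleleft> a)) \<cdot> t)"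
      unfolding e\<^sub>0_s[OF a] by simp
    also have "\<dots> = (c \<triangleleft> a) \<cdot> ((e\<^sub>0 \<triangleleft> a) \<cdot> (r\<^sub>1 \<triangleleft> a))"
      using vcomp_tail[OF c_natural[OF Pa hom(6)], of "r\<^sub>1 \<triangleleft> a"] by (simp add: r\<^sub>1_t)
    finally show "(coCyl \<triangleright> (e\<^sub>0 \<triangleleft> a)) \<cdot> ?\<sigma> = (c \<triangleleft> a) \<cdot> ((e\<^sub>0 \<triangleleft> a) \<cdot> (r\<^sub>1 \<triangleleft> a))" .
    have "(coCyl \<triangleright> (e\<^sub>1 \<triangleleft> a)) \<cdot> ?\<sigma> = (coCyl \<triangleright> ((e\<^sub>1 \<triangleleft> a) \<cdot> (s \<triangleleft> a))) \<cdot> t" by simp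
    also have "\<dots> = (coCyl \<triangleright> (e\<^sub>1 \<triangleleft> a)) \<cdot> ((coCyl \<triangleright> (r\<^sub>0 \<triangleleft> a)) \<cdot> t)"
      unfolding e\<^sub>1_s[OF a] by simp
    also have "\<dots> = r\<^sub>0 \<triangleleft> a"
      using vcomp_tail[OF Pe\<^sub>1_\<Gamma>[OF a], of "r\<^sub>0 \<triangleleft> a"] by (simp add: r\<^sub>0_t)
    finally show "(coCyl \<triangleright> (e\<^sub>1 \<triangleleft> a)) \<cdot> ?\<sigma> = r\<^sub>0 \<triangleleft> a" .
    have "?\<sigma> \<cdot> (qr \<triangleleft> a) = (coCyl \<triangleright> ((s \<triangleleft> a) \<cdot> (qr \<triangleleft> a))) \<cdot> (c \<triangleleft> (coCyl \<odot> a))"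
      by (simp add: t_qr)
    also have "\<dots> = c \<triangleleft> (coCyl \<odot> a)"
      unfolding s_qr[OF a] by simp
    finally show "?\<sigma> \<cdot> (qr \<triangleleft> a) = c \<triangleleft> (coCyl \<odot> a)" .
  qed
qed

section \<open>Homotopy extension for strong deformation retracts\<close>

text \<open>The extension \<open>k\<close> is the concatenation of \<open>w\<close>, the reverse of the path \<open>f(D)\<close> from \<open>f j r\<close> to \<open>f\<close>,
  with the path \<open>h r\<close>, which starts at \<open>f j r\<close>. Restricted along \<open>j\<close>, the path \<open>w\<close> is constant, since
  \<open>D j\<close> is constant and \<open>v c = c\<close>; so \<open>k j\<close> is \<open>h r j = h\<close> by strictness of identities.\<close>

lemma deformation_retract_extension:
  assumes a: "object a" and b: "object b"
    and j: "j \<in> hom2 C a b" and r: "r \<in> hom2 C b a" and rj: "r \<cdot> j = id2 C a"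
    and D: "D \<in> hom2 C b (coCyl \<odot> b)" and D0: "(e\<^sub>0 \<triangleleft> b) \<cdot> D = j \<cdot> r"
    and D1: "(e\<^sub>1 \<triangleleft> b) \<cdot> D = id2 C b" and Dj: "D \<cdot> j = (c \<triangleleft> b) \<cdot> j"
    and a': "object a'" and f: "f \<in> hom2 C b a'" and h: "h \<in> hom2 C a (coCyl \<odot> a')"
    and e\<^sub>0_h: "(e\<^sub>0 \<triangleleft> a') \<cdot> h = f \<cdot> j"
  obtains k where "k \<in> hom2 C b (coCyl \<odot> a')" "k \<cdot> j = h" "(e\<^sub>0 \<triangleleft> a') \<cdot> k = f"
proof -
  note [simp] = a b a' hom2D[OF j] hom2D[OF r] hom2D[OF D] hom2D[OF f] hom2D[OF h]
  let ?w = "(v \<triangleleft> a') \<cdot> ((coCyl \<triangleright> f) \<cdot> D)"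
  have "(e\<^sub>1 \<triangleleft> a') \<cdot> ?w = (e\<^sub>0 \<triangleleft> a') \<cdot> ((coCyl \<triangleright> f) \<cdot> D)"
    using vcomp_tail[OF e\<^sub>1_v[OF a'], of "(coCyl \<triangleright> f) \<cdot> D"] by simp
  also have "\<dots> = f \<cdot> (j \<cdot> r)"
    using vcomp_tail[OF e\<^sub>0_natural[OF b f], of D] by (simp add: D0)
  finally have w1: "(e\<^sub>1 \<triangleleft> a') \<cdot> ?w = f \<cdot> (j \<cdot> r)" .
  have "(e\<^sub>0 \<triangleleft> a') \<cdot> ?w = (e\<^sub>1 \<triangleleft> a') \<cdot> ((coCyl \<triangleright> f) \<cdot> D)"
    using vcomp_tail[OF e\<^sub>0_v[OF a'], of "(coCyl \<triangleright> f) \<cdot> D"] by simp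
  also have "\<dots> = f"
    using vcomp_tail[OF e\<^sub>1_natural[OF b f], of D] by (simp add: D1)
  finally have w0: "(e\<^sub>0 \<triangleleft> a') \<cdot> ?w = f" .
  have "?w \<cdot> j = (v \<triangleleft> a') \<cdot> ((coCyl \<triangleright> f) \<cdot> ((c \<triangleleft> b) \<cdot> j))"
    by (simp add: Dj)
  also have "\<dots> = (v \<triangleleft> a') \<cdot> ((c \<triangleleft> a') \<cdot> (f \<cdot> j))"
    using vcomp_tail[OF c_natural[OF b f], of j] by simp
  also have "\<dots> = (c \<triangleleft> a') \<cdot> ((e\<^sub>0 \<triangleleft> a') \<cdot> h)"
    using vcomp_tail[OF v_c[OF a'], of "f \<cdot> j"] by (simp add: e\<^sub>0_h)
  finally have wj: "?w \<cdot> j = (c \<triangleleft> a') \<cdot> ((e\<^sub>0 \<triangleleft> a') \<cdot> h)" .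
  have compat: "(e\<^sub>0 \<triangleleft> a') \<cdot> (h \<cdot> r) = (e\<^sub>1 \<triangleleft> a') \<cdot> ?w"
    unfolding w1 using vcomp_tail[OF e\<^sub>0_h, of r] by simp
  obtain z where z: "z \<in> hom2 C b (S \<odot> a')" and r\<^sub>0_z: "(r\<^sub>0 \<triangleleft> a') \<cdot> z = h \<cdot> r"
    and r\<^sub>1_z: "(r\<^sub>1 \<triangleleft> a') \<cdot> z = ?w"
    by (rule pullback_lift[OF S_eval_pullback[OF a'] b _ _ _ _ compat, of "S \<odot> a'"
          "coCyl \<odot> a'" "coCyl \<odot> a'"]) (auto intro: hom2I)
  note [simp] = hom2D[OF z]
  have zj: "z \<cdot> j = (ql \<triangleleft> a') \<cdot> h"
  proof (rule pullback_joint_mono[OF S_eval_pullback[OF a'] a])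
    show "(r\<^sub>0 \<triangleleft> a') \<cdot> (z \<cdot> j) = (r\<^sub>0 \<triangleleft> a') \<cdot> ((ql \<triangleleft> a') \<cdot> h)"
      using vcomp_tail[OF r\<^sub>0_z, of j] vcomp_tail[OF r\<^sub>0_ql[OF a'], of h] by (simp add: rj)
    have "(r\<^sub>1 \<triangleleft> a') \<cdot> (z \<cdot> j) = ?w \<cdot> j"
      using vcomp_tail[OF r\<^sub>1_z, of j] by simp
    also have "\<dots> = (r\<^sub>1 \<triangleleft> a') \<cdot> ((ql \<triangleleft> a') \<cdot> h)"
      unfolding wj using vcomp_tail[OF r\<^sub>1_ql[OF a'], of h] by simp
    finally show "(r\<^sub>1 \<triangleleft> a') \<cdot> (z \<cdot> j) = (r\<^sub>1 \<triangleleft> a') \<cdot> ((ql \<triangleleft> a') \<cdot> h)" .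
  qed (auto intro: hom2I)
  show thesis
  proof
    show "(s \<triangleleft> a') \<cdot> z \<in> hom2 C b (coCyl \<odot> a')" by (auto intro: hom2I)
    show "((s \<triangleleft> a') \<cdot> z) \<cdot> j = h"
      using vcomp_tail[OF s_ql[OF a'], of h] by (simp add: zj)
    have "(e\<^sub>0 \<triangleleft> a') \<cdot> ((s \<triangleleft> a') \<cdot> z) = (e\<^sub>0 \<triangleleft> a') \<cdot> ?w"
      using vcomp_tail[OF e\<^sub>0_s[OF a'], of z] by (simp add: r\<^sub>1_z)
    then show "(e\<^sub>0 \<triangleleft> a') \<cdot> ((s \<triangleleft> a') \<cdot> z) = f" by (simp only: w0)
  qed
qed

end

section \<open>The mapping co-cylinder factorisation\<close>

locale cocylinder_factorisation = structured_cocylinder +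
  fixes a\<^sub>0 a\<^sub>1 b f d\<^sub>0 d\<^sub>1 j g
  assumes a\<^sub>0: "object a\<^sub>0" and a\<^sub>1: "object a\<^sub>1" and f: "f \<in> hom2 C a\<^sub>0 a\<^sub>1"
    and mapping: "mapping_cocylinder C one A coCyl e\<^sub>0 a\<^sub>0 a\<^sub>1 f b d\<^sub>0 d\<^sub>1"
    and factorisation: "mapping_cocylinder_factorisation C e\<^sub>1 c a\<^sub>0 a\<^sub>1 f b d\<^sub>0 d\<^sub>1 j g"
begin

lemma b: "object b" and d\<^sub>0: "d\<^sub>0 \<in> hom2 C b a\<^sub>0" and d\<^sub>1: "d\<^sub>1 \<in> hom2 C b (coCyl \<odot> a\<^sub>1)"
  and b_pullback: "pullback_square C one A d\<^sub>0 d\<^sub>1 f (e\<^sub>0 \<triangleleft> a\<^sub>1)"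
  using mapping unfolding mapping_cocylinder_def by blast+

lemma j: "j \<in> hom2 C a\<^sub>0 b" and d\<^sub>0_j: "d\<^sub>0 \<cdot> j = id2 C a\<^sub>0" and d\<^sub>1_j: "d\<^sub>1 \<cdot> j = (c \<triangleleft> a\<^sub>1) \<cdot> f"
  and g_eq: "g = (e\<^sub>1 \<triangleleft> a\<^sub>1) \<cdot> d\<^sub>1"
  using factorisation unfolding mapping_cocylinder_factorisation_def by blast+

declare a\<^sub>0 [simp] a\<^sub>1 [simp] b [simp] f [THEN hom2D, simp] d\<^sub>0 [THEN hom2D, simp]
  d\<^sub>1 [THEN hom2D, simp] j [THEN hom2D, simp]

lemma f_d\<^sub>0: "f \<cdot> d\<^sub>0 = (e\<^sub>0 \<triangleleft> a\<^sub>1) \<cdot> d\<^sub>1"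
  by (rule pullback_square_commutes[OF b_pullback])

lemma P_b_pullback:
  "pullback_square C one A (coCyl \<triangleright> d\<^sub>0) (coCyl \<triangleright> d\<^sub>1) (coCyl \<triangleright> f) (coCyl \<triangleright> (e\<^sub>0 \<triangleleft> a\<^sub>1))"
  using preserves a\<^sub>0 a\<^sub>1 f mapping unfolding preserves_mapping_cocylinders_def by blast

text \<open>The deformation is the arrow into \<open>P(b)\<close> with components \<open>c d\<^sub>0\<close> and \<open>\<Gamma> d\<^sub>1\<close>; its properties are
  checked after projecting to \<open>a\<^sub>0\<close> and to \<open>P(a\<^sub>1)\<close>.\<close>

lemma deformation:
  obtains D where "D \<in> hom2 C b (coCyl \<odot> b)" "(e\<^sub>0 \<triangleleft> b) \<cdot> D = j \<cdot> d\<^sub>0" "(e\<^sub>1 \<triangleleft> b) \<cdot> D = id2 C b"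
    "D \<cdot> j = (c \<triangleleft> b) \<cdot> j"
proof -
  have Pa\<^sub>1: "object (coCyl \<odot> a\<^sub>1)" by simp
  have "(coCyl \<triangleright> f) \<cdot> ((c \<triangleleft> a\<^sub>0) \<cdot> d\<^sub>0) = (c \<triangleleft> a\<^sub>1) \<cdot> (f \<cdot> d\<^sub>0)"
    using vcomp_tail[OF c_natural[OF a\<^sub>0 f], of d\<^sub>0] by simp
  also have "\<dots> = (coCyl \<triangleright> (e\<^sub>0 \<triangleleft> a\<^sub>1)) \<cdot> ((\<Gamma> \<triangleleft> a\<^sub>1) \<cdot> d\<^sub>1)"
    unfolding f_d\<^sub>0 using vcomp_tail[OF Pe\<^sub>0_\<Gamma>[OF a\<^sub>1], of d\<^sub>1] by simp
  finally have compat: "(coCyl \<triangleright> f) \<cdot> ((c \<triangleleft> a\<^sub>0) \<cdot> d\<^sub>0) = (coCyl \<triangleright> (e\<^sub>0 \<triangleleft> a\<^sub>1)) \<cdot> ((\<Gamma> \<triangleleft> a\<^sub>1) \<cdot> d\<^sub>1)" .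
  obtain D where D: "D \<in> hom2 C b (coCyl \<odot> b)" and d\<^sub>0_D: "(coCyl \<triangleright> d\<^sub>0) \<cdot> D = (c \<triangleleft> a\<^sub>0) \<cdot> d\<^sub>0"
    and d\<^sub>1_D: "(coCyl \<triangleright> d\<^sub>1) \<cdot> D = (\<Gamma> \<triangleleft> a\<^sub>1) \<cdot> d\<^sub>1"
    by (rule pullback_lift[OF P_b_pullback b _ _ _ _ compat, of "coCyl \<odot> b" "coCyl \<odot> a\<^sub>0"
          "coCyl \<odot> (coCyl \<odot> a\<^sub>1)"]) (auto intro: hom2I)
  note [simp] = hom2D[OF D]
  show thesis
  proof
    show "D \<in> hom2 C b (coCyl \<odot> b)" by (rule D)
    show "(e\<^sub>0 \<triangleleft> b) \<cdot> D = j \<cdot> d\<^sub>0"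
    proof (rule pullback_joint_mono[OF b_pullback b])
      have "d\<^sub>0 \<cdot> ((e\<^sub>0 \<triangleleft> b) \<cdot> D) = (e\<^sub>0 \<triangleleft> a\<^sub>0) \<cdot> ((c \<triangleleft> a\<^sub>0) \<cdot> d\<^sub>0)"
        using vcomp_tail[OF e\<^sub>0_natural[OF b d\<^sub>0], of D] by (simp add: d\<^sub>0_D)
      also have "\<dots> = d\<^sub>0 \<cdot> (j \<cdot> d\<^sub>0)"
        using vcomp_tail[OF e\<^sub>0_c[OF a\<^sub>0], of d\<^sub>0] vcomp_tail[OF d\<^sub>0_j, of d\<^sub>0] by simp
      finally show "d\<^sub>0 \<cdot> ((e\<^sub>0 \<triangleleft> b) \<cdot> D) = d\<^sub>0 \<cdot> (j \<cdot> d\<^sub>0)" .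
      have "d\<^sub>1 \<cdot> ((e\<^sub>0 \<triangleleft> b) \<cdot> D) = (e\<^sub>0 \<triangleleft> (coCyl \<odot> a\<^sub>1)) \<cdot> ((\<Gamma> \<triangleleft> a\<^sub>1) \<cdot> d\<^sub>1)"
        using vcomp_tail[OF e\<^sub>0_natural[OF b d\<^sub>1], of D] by (simp add: d\<^sub>1_D)
      also have "\<dots> = (c \<triangleleft> a\<^sub>1) \<cdot> (f \<cdot> d\<^sub>0)"
        unfolding f_d\<^sub>0 using vcomp_tail[OF e\<^sub>0_\<Gamma>[OF a\<^sub>1], of d\<^sub>1] by simp
      also have "\<dots> = d\<^sub>1 \<cdot> (j \<cdot> d\<^sub>0)"
        using vcomp_tail[OF d\<^sub>1_j, of d\<^sub>0] by simp
      finally show "d\<^sub>1 \<cdot> ((e\<^sub>0 \<triangleleft> b) \<cdot> D) = d\<^sub>1 \<cdot> (j \<cdot> d\<^sub>0)" .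
    qed (auto intro: hom2I)
    show "(e\<^sub>1 \<triangleleft> b) \<cdot> D = id2 C b"
    proof (rule pullback_joint_mono[OF b_pullback b])
      show "d\<^sub>0 \<cdot> ((e\<^sub>1 \<triangleleft> b) \<cdot> D) = d\<^sub>0 \<cdot> id2 C b"
        using vcomp_tail[OF e\<^sub>1_natural[OF b d\<^sub>0], of D] vcomp_tail[OF e\<^sub>1_c[OF a\<^sub>0], of d\<^sub>0]
        by (simp add: d\<^sub>0_D)
      show "d\<^sub>1 \<cdot> ((e\<^sub>1 \<triangleleft> b) \<cdot> D) = d\<^sub>1 \<cdot> id2 C b"
        using vcomp_tail[OF e\<^sub>1_natural[OF b d\<^sub>1], of D] vcomp_tail[OF e\<^sub>1_\<Gamma>[OF a\<^sub>1], of d\<^sub>1]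
        by (simp add: d\<^sub>1_D)
    qed (auto intro: hom2I)
    show "D \<cdot> j = (c \<triangleleft> b) \<cdot> j"
    proof (rule pullback_joint_mono[OF P_b_pullback a\<^sub>0])
      show "(coCyl \<triangleright> d\<^sub>0) \<cdot> (D \<cdot> j) = (coCyl \<triangleright> d\<^sub>0) \<cdot> ((c \<triangleleft> b) \<cdot> j)"
        using vcomp_tail[OF d\<^sub>0_D, of j] vcomp_tail[OF c_natural[OF b d\<^sub>0], of j] by simp
      have "(coCyl \<triangleright> d\<^sub>1) \<cdot> (D \<cdot> j) = (\<Gamma> \<triangleleft> a\<^sub>1) \<cdot> ((c \<triangleleft> a\<^sub>1) \<cdot> f)"
        using vcomp_tail[OF d\<^sub>1_D, of j] by (simp add: d\<^sub>1_j)
      also have "\<dots> = (c \<triangleleft> (coCyl \<odot> a\<^sub>1)) \<cdot> (d\<^sub>1 \<cdot> j)"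
        unfolding d\<^sub>1_j using vcomp_tail[OF \<Gamma>_c[OF a\<^sub>1], of f] by simp
      also have "\<dots> = (coCyl \<triangleright> d\<^sub>1) \<cdot> ((c \<triangleleft> b) \<cdot> j)"
        using vcomp_tail[OF c_natural[OF b d\<^sub>1], of j] by simp
      finally show "(coCyl \<triangleright> d\<^sub>1) \<cdot> (D \<cdot> j) = (coCyl \<triangleright> d\<^sub>1) \<cdot> ((c \<triangleleft> b) \<cdot> j)" .
    qed (auto intro: hom2I)
  qed
qed

text \<open>The lift of \<open>h\<close> through \<open>x\<close> has components \<open>c d\<^sub>0 x\<close> and \<open>\<sigma>(h, d\<^sub>1 x)\<close>. These components determine it,
  so normality and stability under precomposition need only be checked on them.\<close>

lemma g_normally_cloven_fibration: "normally_cloven_fibration C one A coCyl e\<^sub>0 c b a\<^sub>1 g"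
proof -
  have Pa\<^sub>1: "object (coCyl \<odot> a\<^sub>1)" by simp
  have g: "g \<in> hom2 C b a\<^sub>1" unfolding g_eq by (auto intro: hom2I)
  obtain \<sigma> where \<sigma>: "\<sigma> \<in> hom2 C (S \<odot> a\<^sub>1) (coCyl \<odot> (coCyl \<odot> a\<^sub>1))"
    and e\<^sub>0_\<sigma>: "(e\<^sub>0 \<triangleleft> (coCyl \<odot> a\<^sub>1)) \<cdot> \<sigma> = r\<^sub>1 \<triangleleft> a\<^sub>1"
    and Pe\<^sub>0_\<sigma>: "(coCyl \<triangleright> (e\<^sub>0 \<triangleleft> a\<^sub>1)) \<cdot> \<sigma> = (c \<triangleleft> a\<^sub>1) \<cdot> ((e\<^sub>0 \<triangleleft> a\<^sub>1) \<cdot> (r\<^sub>1 \<triangleleft> a\<^sub>1))"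
    and Pe\<^sub>1_\<sigma>: "(coCyl \<triangleright> (e\<^sub>1 \<triangleleft> a\<^sub>1)) \<cdot> \<sigma> = r\<^sub>0 \<triangleleft> a\<^sub>1"
    and \<sigma>_qr: "\<sigma> \<cdot> (qr \<triangleleft> a\<^sub>1) = c \<triangleleft> (coCyl \<odot> a\<^sub>1)"
    using connection_square[OF a\<^sub>1] by metis
  note [simp] = hom2D[OF \<sigma>]
  \<comment> \<open>\<open>L w x h k\<close> says that \<open>k\<close> has the prescribed components; \<open>z\<close> is the composable pair formed by
    \<open>d\<^sub>1 x\<close> and \<open>h\<close>.\<close>
  define L where "L w x h k \<longleftrightarrow> k \<in> hom2 C w (coCyl \<odot> b) \<and> (coCyl \<triangleright> d\<^sub>0) \<cdot> k = (c \<triangleleft> a\<^sub>0) \<cdot> (d\<^sub>0 \<cdot> x) \<and>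
    (\<exists>z \<in> hom2 C w (S \<odot> a\<^sub>1). (r\<^sub>0 \<triangleleft> a\<^sub>1) \<cdot> z = h \<and> (r\<^sub>1 \<triangleleft> a\<^sub>1) \<cdot> z = d\<^sub>1 \<cdot> x \<and> (coCyl \<triangleright> d\<^sub>1) \<cdot> k = \<sigma> \<cdot> z)"
    for w x h k
  have L_unique: "k = k'" if w: "object w" and k: "L w x h k" and k': "L w x h k'" for w x h k k'
  proof -
    obtain z where z: "z \<in> hom2 C w (S \<odot> a\<^sub>1)" "(r\<^sub>0 \<triangleleft> a\<^sub>1) \<cdot> z = h" "(r\<^sub>1 \<triangleleft> a\<^sub>1) \<cdot> z = d\<^sub>1 \<cdot> x"
      "(coCyl \<triangleright> d\<^sub>1) \<cdot> k = \<sigma> \<cdot> z" using k unfolding L_def by blast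
    obtain z' where z': "z' \<in> hom2 C w (S \<odot> a\<^sub>1)" "(r\<^sub>0 \<triangleleft> a\<^sub>1) \<cdot> z' = h" "(r\<^sub>1 \<triangleleft> a\<^sub>1) \<cdot> z' = d\<^sub>1 \<cdot> x"
      "(coCyl \<triangleright> d\<^sub>1) \<cdot> k' = \<sigma> \<cdot> z'" using k' unfolding L_def by blast
    have zz: "z = z'"
    proof (rule pullback_joint_mono[OF S_eval_pullback[OF a\<^sub>1] w])
      show "z \<in> hom2 C w (src2 C (r\<^sub>0 \<triangleleft> a\<^sub>1))" "z' \<in> hom2 C w (src2 C (r\<^sub>0 \<triangleleft> a\<^sub>1))"
        using z(1) z'(1) by simp_all
    qed (simp_all only: z z')
    show ?thesis
    proof (rule pullback_joint_mono[OF P_b_pullback w])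
      show "k \<in> hom2 C w (src2 C (coCyl \<triangleright> d\<^sub>0))" "k' \<in> hom2 C w (src2 C (coCyl \<triangleright> d\<^sub>0))"
        using k k' unfolding L_def by simp_all
      show "(coCyl \<triangleright> d\<^sub>0) \<cdot> k = (coCyl \<triangleright> d\<^sub>0) \<cdot> k'"
        using k k' unfolding L_def by (simp only:)
    qed (simp only: z z' zz)
  qed
  have L_exists: "\<exists>k. L w x h k"
    if w: "object w" and x: "x \<in> hom2 C w b" and h: "h \<in> hom2 C w (coCyl \<odot> a\<^sub>1)"
      and e\<^sub>0_h: "(e\<^sub>0 \<triangleleft> a\<^sub>1) \<cdot> h = g \<cdot> x" for w x h
  proof -
    note [simp] = w hom2D[OF x] hom2D[OF h]
    have compat: "(e\<^sub>0 \<triangleleft> a\<^sub>1) \<cdot> h = (e\<^sub>1 \<triangleleft> a\<^sub>1) \<cdot> (d\<^sub>1 \<cdot> x)"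
      using e\<^sub>0_h by (simp add: g_eq)
    obtain z where z: "z \<in> hom2 C w (S \<odot> a\<^sub>1)" and r\<^sub>0_z: "(r\<^sub>0 \<triangleleft> a\<^sub>1) \<cdot> z = h"
      and r\<^sub>1_z: "(r\<^sub>1 \<triangleleft> a\<^sub>1) \<cdot> z = d\<^sub>1 \<cdot> x"
      by (rule pullback_lift[OF S_eval_pullback[OF a\<^sub>1] w _ _ _ _ compat, of "S \<odot> a\<^sub>1"
          "coCyl \<odot> a\<^sub>1" "coCyl \<odot> a\<^sub>1"]) (auto intro: hom2I)
    note [simp] = hom2D[OF z]
    have "(coCyl \<triangleright> f) \<cdot> ((c \<triangleleft> a\<^sub>0) \<cdot> (d\<^sub>0 \<cdot> x)) = (c \<triangleleft> a\<^sub>1) \<cdot> ((e\<^sub>0 \<triangleleft> a\<^sub>1) \<cdot> (d\<^sub>1 \<cdot> x))"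
      using vcomp_tail[OF c_natural[OF a\<^sub>0 f], of "d\<^sub>0 \<cdot> x"] vcomp_tail[OF f_d\<^sub>0, of x] by simp
    also have "\<dots> = (coCyl \<triangleright> (e\<^sub>0 \<triangleleft> a\<^sub>1)) \<cdot> (\<sigma> \<cdot> z)"
      using vcomp_tail[OF Pe\<^sub>0_\<sigma>, of z] by (simp add: r\<^sub>1_z)
    finally have compat': "(coCyl \<triangleright> f) \<cdot> ((c \<triangleleft> a\<^sub>0) \<cdot> (d\<^sub>0 \<cdot> x)) = (coCyl \<triangleright> (e\<^sub>0 \<triangleleft> a\<^sub>1)) \<cdot> (\<sigma> \<cdot> z)" .
    obtain k where "k \<in> hom2 C w (coCyl \<odot> b)" "(coCyl \<triangleright> d\<^sub>0) \<cdot> k = (c \<triangleleft> a\<^sub>0) \<cdot> (d\<^sub>0 \<cdot> x)"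
      "(coCyl \<triangleright> d\<^sub>1) \<cdot> k = \<sigma> \<cdot> z"
      by (rule pullback_lift[OF P_b_pullback w _ _ _ _ compat', of "coCyl \<odot> b" "coCyl \<odot> a\<^sub>0"
            "coCyl \<odot> (coCyl \<odot> a\<^sub>1)"]) (auto intro: hom2I)
    then show ?thesis unfolding L_def using z r\<^sub>0_z r\<^sub>1_z by blast
  qed
  have L_lift: "(coCyl \<triangleright> g) \<cdot> k = h \<and> (e\<^sub>0 \<triangleleft> b) \<cdot> k = x"
    if w: "object w" and x: "x \<in> hom2 C w b" and k: "L w x h k" for w x h k
  proof
    obtain z where z: "z \<in> hom2 C w (S \<odot> a\<^sub>1)" and r\<^sub>0_z: "(r\<^sub>0 \<triangleleft> a\<^sub>1) \<cdot> z = h"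
      and r\<^sub>1_z: "(r\<^sub>1 \<triangleleft> a\<^sub>1) \<cdot> z = d\<^sub>1 \<cdot> x" and d\<^sub>1_k: "(coCyl \<triangleright> d\<^sub>1) \<cdot> k = \<sigma> \<cdot> z"
      using k unfolding L_def by blast
    have k_hom: "k \<in> hom2 C w (coCyl \<odot> b)" and d\<^sub>0_k: "(coCyl \<triangleright> d\<^sub>0) \<cdot> k = (c \<triangleleft> a\<^sub>0) \<cdot> (d\<^sub>0 \<cdot> x)"
      using k unfolding L_def by blast+
    note [simp] = w hom2D[OF x] hom2D[OF k_hom] hom2D[OF z]
    show "(coCyl \<triangleright> g) \<cdot> k = h"
      using vcomp_tail[OF Pe\<^sub>1_\<sigma>, of z] by (simp add: g_eq d\<^sub>1_k r\<^sub>0_z)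
    show "(e\<^sub>0 \<triangleleft> b) \<cdot> k = x"
    proof (rule pullback_joint_mono[OF b_pullback w])
      show "d\<^sub>0 \<cdot> ((e\<^sub>0 \<triangleleft> b) \<cdot> k) = d\<^sub>0 \<cdot> x"
        using vcomp_tail[OF e\<^sub>0_natural[OF b d\<^sub>0], of k] vcomp_tail[OF e\<^sub>0_c[OF a\<^sub>0], of "d\<^sub>0 \<cdot> x"]
        by (simp add: d\<^sub>0_k)
      show "d\<^sub>1 \<cdot> ((e\<^sub>0 \<triangleleft> b) \<cdot> k) = d\<^sub>1 \<cdot> x"
        using vcomp_tail[OF e\<^sub>0_natural[OF b d\<^sub>1], of k] vcomp_tail[OF e\<^sub>0_\<sigma>, of z]
        by (simp add: d\<^sub>1_k r\<^sub>1_z)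
    qed (auto intro: hom2I)
  qed
  have L_normal: "L w x ((c \<triangleleft> a\<^sub>1) \<cdot> (g \<cdot> x)) ((c \<triangleleft> b) \<cdot> x)"
    if w: "object w" and x: "x \<in> hom2 C w b" for w x
    unfolding L_def
  proof (intro conjI bexI[of _ "(qr \<triangleleft> a\<^sub>1) \<cdot> (d\<^sub>1 \<cdot> x)"])
    note [simp] = w hom2D[OF x]
    show "(c \<triangleleft> b) \<cdot> x \<in> hom2 C w (coCyl \<odot> b)"
      "(qr \<triangleleft> a\<^sub>1) \<cdot> (d\<^sub>1 \<cdot> x) \<in> hom2 C w (S \<odot> a\<^sub>1)" by (auto intro: hom2I)
    show "(coCyl \<triangleright> d\<^sub>0) \<cdot> ((c \<triangleleft> b) \<cdot> x) = (c \<triangleleft> a\<^sub>0) \<cdot> (d\<^sub>0 \<cdot> x)"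
      using vcomp_tail[OF c_natural[OF b d\<^sub>0], of x] by simp
    show "(r\<^sub>0 \<triangleleft> a\<^sub>1) \<cdot> ((qr \<triangleleft> a\<^sub>1) \<cdot> (d\<^sub>1 \<cdot> x)) = (c \<triangleleft> a\<^sub>1) \<cdot> (g \<cdot> x)"
      using vcomp_tail[OF r\<^sub>0_qr[OF a\<^sub>1], of "d\<^sub>1 \<cdot> x"] by (simp add: g_eq)
    show "(r\<^sub>1 \<triangleleft> a\<^sub>1) \<cdot> ((qr \<triangleleft> a\<^sub>1) \<cdot> (d\<^sub>1 \<cdot> x)) = d\<^sub>1 \<cdot> x"
      using vcomp_tail[OF r\<^sub>1_qr[OF a\<^sub>1], of "d\<^sub>1 \<cdot> x"] by simp
    show "(coCyl \<triangleright> d\<^sub>1) \<cdot> ((c \<triangleleft> b) \<cdot> x) = \<sigma> \<cdot> ((qr \<triangleleft> a\<^sub>1) \<cdot> (d\<^sub>1 \<cdot> x))"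
      using vcomp_tail[OF c_natural[OF b d\<^sub>1], of x] vcomp_tail[OF \<sigma>_qr, of "d\<^sub>1 \<cdot> x"] by simp
  qed
  have L_stable: "L w' (x \<cdot> u) (h \<cdot> u) (k \<cdot> u)"
    if w: "object w" and w': "object w'" and x: "x \<in> hom2 C w b" and u: "u \<in> hom2 C w' w"
      and k: "L w x h k" for w w' x h k u
  proof -
    obtain z where z: "z \<in> hom2 C w (S \<odot> a\<^sub>1)" and r\<^sub>0_z: "(r\<^sub>0 \<triangleleft> a\<^sub>1) \<cdot> z = h"
      and r\<^sub>1_z: "(r\<^sub>1 \<triangleleft> a\<^sub>1) \<cdot> z = d\<^sub>1 \<cdot> x" and d\<^sub>1_k: "(coCyl \<triangleright> d\<^sub>1) \<cdot> k = \<sigma> \<cdot> z"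
      using k unfolding L_def by blast
    have k_hom: "k \<in> hom2 C w (coCyl \<odot> b)" and d\<^sub>0_k: "(coCyl \<triangleright> d\<^sub>0) \<cdot> k = (c \<triangleleft> a\<^sub>0) \<cdot> (d\<^sub>0 \<cdot> x)"
      using k unfolding L_def by blast+
    note [simp] = w w' hom2D[OF x] hom2D[OF k_hom] hom2D[OF z] hom2D[OF u]
    show ?thesis
      unfolding L_def
    proof (intro conjI bexI[of _ "z \<cdot> u"])
      show "k \<cdot> u \<in> hom2 C w' (coCyl \<odot> b)" "z \<cdot> u \<in> hom2 C w' (S \<odot> a\<^sub>1)" by (auto intro: hom2I)
      show "(coCyl \<triangleright> d\<^sub>0) \<cdot> (k \<cdot> u) = (c \<triangleleft> a\<^sub>0) \<cdot> (d\<^sub>0 \<cdot> (x \<cdot> u))"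
        using vcomp_tail[OF d\<^sub>0_k, of u] by simp
      show "(r\<^sub>0 \<triangleleft> a\<^sub>1) \<cdot> (z \<cdot> u) = h \<cdot> u" using vcomp_tail[OF r\<^sub>0_z, of u] by simp
      show "(r\<^sub>1 \<triangleleft> a\<^sub>1) \<cdot> (z \<cdot> u) = d\<^sub>1 \<cdot> (x \<cdot> u)" using vcomp_tail[OF r\<^sub>1_z, of u] by simp
      show "(coCyl \<triangleright> d\<^sub>1) \<cdot> (k \<cdot> u) = \<sigma> \<cdot> (z \<cdot> u)" using vcomp_tail[OF d\<^sub>1_k, of u] by simp
    qed
  qed
  define K where "K w x h = (THE k. L w x h k)" for w x h
  have K_eq: "K w x h = k" if "object w" "L w x h k" for w x h k
    unfolding K_def by (rule the_equality[of "L w x h", OF that(2) L_unique[OF that(1) _ that(2)]])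
  have K_L: "L w x h (K w x h)"
    if *: "object w" "x \<in> hom2 C w b" "h \<in> hom2 C w (coCyl \<odot> a\<^sub>1)" "(e\<^sub>0 \<triangleleft> a\<^sub>1) \<cdot> h = g \<cdot> x" for w x h
  proof -
    obtain k where "L w x h k" using L_exists[OF *] by blast
    then show ?thesis using K_eq[OF *(1)] by (simp only:)
  qed
  show ?thesis
    unfolding normally_cloven_fibration_def
  proof (intro conjI exI[of _ K] ballI impI)
    show "g \<in> hom2 C b a\<^sub>1" by (rule g)
  next
    fix w x h
    assume *: "object w" "x \<in> hom2 C w b" "h \<in> hom2 C w (coCyl \<odot> a\<^sub>1)" "(e\<^sub>0 \<triangleleft> a\<^sub>1) \<cdot> h = g \<cdot> x"
    show "K w x h \<in> hom2 C w (coCyl \<odot> b)" using K_L[OF *] unfolding L_def by blast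
    show "(coCyl \<triangleright> g) \<cdot> K w x h = h" "(e\<^sub>0 \<triangleleft> b) \<cdot> K w x h = x"
      using L_lift[OF *(1,2) K_L[OF *]] by blast+
    fix w' u assume "object w'" "u \<in> hom2 C w' w"
    then show "K w' (x \<cdot> u) (h \<cdot> u) = K w x h \<cdot> u"
      using K_eq L_stable[OF *(1) _ *(2) _ K_L[OF *]] by blast
  next
    fix w x assume "object w" "x \<in> hom2 C w b"
    then show "K w x ((c \<triangleleft> a\<^sub>1) \<cdot> (g \<cdot> x)) = (c \<triangleleft> b) \<cdot> x"
      using K_eq L_normal by blast
  qed
qed

text \<open>Under \<open>adj\<close>, homotopies become paths with the same two ends, and restriction along
  \<open>Cyl(j)\<close> becomes precomposition with \<open>j\<close>. Hence extending homotopies along \<open>j\<close> is extending paths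
  along \<open>j\<close>, and the deformation of \<open>j d\<^sub>0\<close> into the identity is a homotopy. As \<open>d\<^sub>0 j\<close> is the identity, the
  other homotopy can be taken constant.\<close>

lemma j_trivial_cofibration:
  assumes cyl: "cylinder C A Cyl i\<^sub>0 i\<^sub>1" and p: "cyl_contraction C A Cyl i\<^sub>0 i\<^sub>1 p"
    and adjunction: "cylinder_adjunction C one A Cyl i\<^sub>0 i\<^sub>1 coCyl e\<^sub>0 e\<^sub>1 \<eta> \<epsilon>"
  shows "trivial_cofibration C one A Cyl i\<^sub>0 i\<^sub>1 a\<^sub>0 b j"
proof -
  have adjn: "adjunction C A A Cyl coCyl \<eta> \<epsilon>"
    using adjunction unfolding cylinder_adjunction_def by blast
  have adj_e\<^sub>0: "(e\<^sub>0 \<triangleleft> y) \<cdot> adj C coCyl \<eta> x h = h \<cdot> (i\<^sub>0 \<triangleleft> x)"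
    and adj_e\<^sub>1: "(e\<^sub>1 \<triangleleft> y) \<cdot> adj C coCyl \<eta> x h = h \<cdot> (i\<^sub>1 \<triangleleft> x)"
    if "object x" "object y" "h \<in> hom2 C (Cyl \<odot> x) y" for x y h
    using adjunction that unfolding cylinder_adjunction_def by blast+
  have Cyl: "Cyl \<in> hom1 C A A" and i: "i\<^sub>0 \<in> hom2 C (id1 C A) Cyl" "i\<^sub>1 \<in> hom2 C (id1 C A) Cyl"
    using cyl unfolding cylinder_def by blast+
  have p_hom: "p \<in> hom2 C Cyl (id1 C A)"
    and p_i: "p \<cdot> i\<^sub>0 = id2 C (id1 C A)" "p \<cdot> i\<^sub>1 = id2 C (id1 C A)"
    using p unfolding cyl_contraction_def by blast+
  note [simp] = hom1D[OF Cyl] hom2D[OF i(1)] hom2D[OF i(2)] hom2D[OF p_hom]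
  obtain D where D: "D \<in> hom2 C b (coCyl \<odot> b)" and D0: "(e\<^sub>0 \<triangleleft> b) \<cdot> D = j \<cdot> d\<^sub>0"
    and D1: "(e\<^sub>1 \<triangleleft> b) \<cdot> D = id2 C b" and Dj: "D \<cdot> j = (c \<triangleleft> b) \<cdot> j"
    by (rule deformation)
  have "cofibration C one A Cyl i\<^sub>0 a\<^sub>0 b j"
    unfolding cofibration_def
  proof (intro conjI ballI impI)
    fix a\<^sub>2 u h
    assume a\<^sub>2: "object a\<^sub>2" and u: "u \<in> hom2 C b a\<^sub>2" and h: "h \<in> hom2 C (Cyl \<odot> a\<^sub>0) a\<^sub>2"
      and eq: "h \<cdot> (i\<^sub>0 \<triangleleft> a\<^sub>0) = u \<cdot> j"
    note [simp] = a\<^sub>2 hom2D[OF u] hom2D[OF h]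
    have "(e\<^sub>0 \<triangleleft> a\<^sub>2) \<cdot> adj C coCyl \<eta> a\<^sub>0 h = u \<cdot> j"
      using adj_e\<^sub>0[OF a\<^sub>0 a\<^sub>2 h] eq by (simp only:)
    then obtain k where k: "k \<in> hom2 C b (coCyl \<odot> a\<^sub>2)" "k \<cdot> j = adj C coCyl \<eta> a\<^sub>0 h"
        "(e\<^sub>0 \<triangleleft> a\<^sub>2) \<cdot> k = u"
      using deformation_retract_extension[OF a\<^sub>0 b j d\<^sub>0 d\<^sub>0_j D D0 D1 Dj a\<^sub>2 u adj_hom[OF adjn a\<^sub>0 a\<^sub>2 h]]
      by blast
    obtain k' where k': "k' \<in> hom2 C (Cyl \<odot> b) a\<^sub>2" "adj C coCyl \<eta> b k' = k"
      using adj_surj[OF adjn b a\<^sub>2 k(1)] by blast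
    note [simp] = hom2D[OF k'(1)]
    show "\<exists>k\<in>hom2 C (Cyl \<odot> b) a\<^sub>2. k \<cdot> (Cyl \<triangleright> j) = h \<and> k \<cdot> (i\<^sub>0 \<triangleleft> b) = u"
    proof (intro bexI[of _ k'] conjI)
      have "adj C coCyl \<eta> a\<^sub>0 (k' \<cdot> (Cyl \<triangleright> j)) = adj C coCyl \<eta> a\<^sub>0 h"
        using adj_natural[OF adjn b a\<^sub>2 k'(1) a\<^sub>0 j] k k' by (simp only:)
      then show "k' \<cdot> (Cyl \<triangleright> j) = h"
        by (intro adj_inj[OF adjn a\<^sub>0 a\<^sub>2 _ h]) (auto intro: hom2I)
      show "k' \<cdot> (i\<^sub>0 \<triangleleft> b) = u"
        using adj_e\<^sub>0[OF b a\<^sub>2 k'(1)] k k' by (simp only:)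
    qed (rule k')
  qed (rule j)
  moreover have "homotopy_equivalence C Cyl i\<^sub>0 i\<^sub>1 a\<^sub>0 b j"
    unfolding homotopy_equivalence_def
  proof (intro conjI bexI[of _ d\<^sub>0])
    have "homotopy C Cyl i\<^sub>0 i\<^sub>1 a\<^sub>0 a\<^sub>0 (d\<^sub>0 \<cdot> j) (id2 C a\<^sub>0) (p \<triangleleft> a\<^sub>0)"
      unfolding homotopy_def d\<^sub>0_j
      using arg_cong[OF p_i(1), of "\<lambda>x. x \<triangleleft> a\<^sub>0"] arg_cong[OF p_i(2), of "\<lambda>x. x \<triangleleft> a\<^sub>0"]
      by (auto intro: hom2I)
    then show "\<exists>h. homotopy C Cyl i\<^sub>0 i\<^sub>1 a\<^sub>0 a\<^sub>0 (d\<^sub>0 \<cdot> j) (id2 C a\<^sub>0) h" ..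
    obtain h where "h \<in> hom2 C (Cyl \<odot> b) b" "adj C coCyl \<eta> b h = D"
      using adj_surj[OF adjn b b D] by blast
    then have "homotopy C Cyl i\<^sub>0 i\<^sub>1 b b (j \<cdot> d\<^sub>0) (id2 C b) h"
      unfolding homotopy_def using adj_e\<^sub>0[OF b b] adj_e\<^sub>1[OF b b] D0 D1 by metis
    then show "\<exists>h. homotopy C Cyl i\<^sub>0 i\<^sub>1 b b (j \<cdot> d\<^sub>0) (id2 C b) h" ..
  qed (rule j d\<^sub>0)+
  ultimately show ?thesis unfolding trivial_cofibration_def by blast
qed

end

theorem mainTheorem11:
  fixes C :: "('o, 'm, 't, 'x) two_cells_scheme"
    and one A :: 'o
    and coCyl S Cyl :: 'm
    and e\<^sub>0 e\<^sub>1 c v r\<^sub>0 r\<^sub>1 s \<Gamma> :: 't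
    and i\<^sub>0 i\<^sub>1 p \<eta> \<epsilon> :: 't
    and a\<^sub>0 a\<^sub>1 b :: 'm
    and f d\<^sub>0 d\<^sub>1 j g :: 't
  assumes "formal_category C one A"
    and "cocylinder C A coCyl e\<^sub>0 e\<^sub>1"
    and "cocyl_contraction C A coCyl e\<^sub>0 e\<^sub>1 c"
    and "involution C coCyl e\<^sub>0 e\<^sub>1 v"
    and "involution_compatible C c v"
    and "subdivision C A coCyl e\<^sub>0 e\<^sub>1 S r\<^sub>0 r\<^sub>1 s"
    and "lower_right_connection C coCyl e\<^sub>0 e\<^sub>1 c \<Gamma>"
    and "connection_compatible C coCyl c \<Gamma>"
    and "strictness_of_identities C coCyl e\<^sub>0 e\<^sub>1 c S r\<^sub>0 r\<^sub>1 s"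
    and "preserves_mapping_cocylinders C one A coCyl e\<^sub>0"
    and "cylinder C A Cyl i\<^sub>0 i\<^sub>1"
    and "cyl_contraction C A Cyl i\<^sub>0 i\<^sub>1 p"
    and "cylinder_adjunction C one A Cyl i\<^sub>0 i\<^sub>1 coCyl e\<^sub>0 e\<^sub>1 \<eta> \<epsilon>"
    and "adjunction_compatible C one A p coCyl c \<eta>"
    and "a\<^sub>0 \<in> hom1 C one A" and "a\<^sub>1 \<in> hom1 C one A" and "f \<in> hom2 C a\<^sub>0 a\<^sub>1"
    and "mapping_cocylinder C one A coCyl e\<^sub>0 a\<^sub>0 a\<^sub>1 f b d\<^sub>0 d\<^sub>1"
    and "mapping_cocylinder_factorisation C e\<^sub>1 c a\<^sub>0 a\<^sub>1 f b d\<^sub>0 d\<^sub>1 j g"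
  shows "trivial_cofibration C one A Cyl i\<^sub>0 i\<^sub>1 a\<^sub>0 b j \<and>
         normally_cloven_fibration C one A coCyl e\<^sub>0 c b a\<^sub>1 g"
proof -
  interpret cocylinder_factorisation C one A coCyl S e\<^sub>0 e\<^sub>1 c v r\<^sub>0 r\<^sub>1 s \<Gamma> a\<^sub>0 a\<^sub>1 b f d\<^sub>0 d\<^sub>1 j g
    using assms
    by (simp add: cocylinder_factorisation_def cocylinder_factorisation_axioms_def
        structured_cocylinder_def structured_cocylinder_axioms_def)
  show ?thesis
    using j_trivial_cofibration[OF assms(11-13)] g_normally_cloven_fibration by blast
qed

end
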